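(* Assume that $\sum_{j\in\mathbb{N}}\sigma_j^2<\infty$. Then the mapping $Q$ is an isometric isomorphism on $L^2(\mu)$, and its restriction $Q|_{H(K)}$ is an isometric isomorphism between $H(K)$ and $H(L_{\mathfrak{X}})$.
   Context: All function spaces are over $\mathbb{R}$; $\mathbb{N}=\{1,2,\dots\}$, $\mathbb{N}_0=\mathbb{N}\cup\{0\}$. For a reproducing kernel (symmetric positive semidefinite function) $M$ on $E\times E$, $H(M)$ denotes the reproducing kernel Hilbert space of real functions on $E$ with kernel $M$. For a sequence of reals, $\prod_{j=1}^\infty a_j:=\lim_{J\to\infty}\prod_{j=1}^J a_j$ whenever the limit exists. $\mu_0$ is the standard normal distribution on $\mathbb{R}$ and $\mu$ is the countable product of $\mu_0$ on $\mathbb{R}^{\mathbb{N}}$ (product $\sigma$-algebra); $L^2(\mu):=L^2(\mathbb{R}^{\mathbb{N}},\mu)$. $h_\nu$, $\nu\in\mathbb{N}_0$, are the $L^2(\mu_0)$-normalized Hermite polynomials, $h_\nu(x)=\sqrt{\nu!}\sum_{k=0}^{\lfloor \nu/2\rfloor}(-1)^k\frac{x^{\nu-2k}}{2^k\,k!\,(\nu-2k)!}$. Let $(\sigma_j)_{j\in\mathbb{N}}$ be a sequence of positive reals, and put $$c_j:=(1+8\sigma_j^2)^{1/4},\qquad \beta_j:=1-\frac{2}{1+c_j^2},\qquad \alpha_{\nu,j}:=\frac{1}{(1-\beta_j)\beta_j^{\nu}}\quad(\nu\in\mathbb{N}_0,\ j\in\mathbb{N}).$$ Let $\mathfrak{X}:=\{\boldsymbol{x}\in\mathbb{R}^{\mathbb{N}}:\sum_{j\in\mathbb{N}}\sigma_j^2x_j^2<\infty\}$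 (under the assumption on $(\sigma_j)$ one has $\mu(\mathfrak{X})=1$, and $L^2(\mathbb{R}^{\mathbb{N}},\mu)$ is identified with $L^2(\mathfrak{X},\mu)$). Hermite kernel: $k_j(x,y):=\sum_{\nu\in\mathbb{N}_0}\alpha_{\nu,j}^{-1}h_\nu(x)h_\nu(y)$ for $x,y\in\mathbb{R}$, and $K(\boldsymbol{x},\boldsymbol{y}):=\prod_{j=1}^\infty k_j(x_j,y_j)$ for $\boldsymbol{x},\boldsymbol{y}\in\mathfrak{X}$ (under the assumption on $(\sigma_j)$ the product converges on $\mathfrak{X}\times\mathfrak{X}$, and $\mathfrak{X}$ is the maximal domain with this property). Gaussian kernel: $\ell_j(x,y):=\exp(-\sigma_j^2(x-y)^2)$ for $x,y\in\mathbb{R}$, and $L_{\mathfrak{X}}(\boldsymbol{x},\boldsymbol{y}):=\prod_{j=1}^\infty\ell_j(x_j,y_j)$ for $\boldsymbol{x},\boldsymbol{y}\in\mathfrak{X}$. Elements of $H(K)$ and $H(L_{\mathfrak{X}})$ are functions on $\mathfrak{X}$, which are square-integrable with respect to $\mu$ and are also regarded as elements of $L^2(\mu)$. Put $c_\ast:=\prod_{j=1}^\infty c_j$ (a finite number greater than 1 under the assumption on $(\sigma_j)$) and $t(\boldsymbol{x}):=(c_1x_1,c_2x_2,\dots)$. For $f\in L^2(\mu)$ and $\boldsymbol{x}\in\mathfrak{X}$ define $$Qf(\boldsymbol{x}):=c_\ast^{1/2}\cdot\exp\Bigl(-\sum_{j\in\mathbb{N}}\frac{c_j^2-1}{4}\,x_j^2\Bigr)\cdot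 f(t(\boldsymbol{x})).$$ *)

theory Defs
  imports "HOL-Probability.Probability"
begin

text \<open>
  Sequences are indexed by \<open>nat\<close>, starting at \<open>0\<close>; the index \<open>j\<close> here stands for \<open>j + 1\<close>
  in the mathematical text, where sequences start at \<open>1\<close>.
  A real function on a set \<open>E\<close> is represented by its extension by \<open>0\<close> to the whole type.
\<close>

text \<open>
  Plain limit of the partial products. Unlike \<^const>\<open>prodinf\<close>, this also covers products
  that tend to \<open>0\<close> without having a zero factor.
\<close>

definition lim_prod :: "(nat \<Rightarrow> real) \<Rightarrow> real" where
  "lim_prod a = lim (\<lambda>J. \<Prod>j<J. a j)"


subsection \<open>Reproducing kernel Hilbert spaces\<close>

definition kernel_section :: "'a set \<Rightarrow> ('a \<Rightarrow> 'a \<Rightarrow> real) \<Rightarrow> 'a \<Rightarrow> 'a \<Rightarrow> real" where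
  "kernel_section E M x = (\<lambda>y. if y \<in> E then M y x else 0)"

locale reproducing_kernel_hilbert_space =
  fixes E :: "'a set"
    and M :: "'a \<Rightarrow> 'a \<Rightarrow> real"
    and H :: "('a \<Rightarrow> real) set"
    and ip :: "('a \<Rightarrow> real) \<Rightarrow> ('a \<Rightarrow> real) \<Rightarrow> real"
  assumes supported: "f \<in> H \<Longrightarrow> x \<notin> E \<Longrightarrow> f x = 0"
    and zero_mem: "(\<lambda>_. 0) \<in> H"
    and add_mem: "f \<in> H \<Longrightarrow> g \<in> H \<Longrightarrow> (\<lambda>x. f x + g x) \<in> H"
    and scale_mem: "f \<in> H \<Longrightarrow> (\<lambda>x. a * f x) \<in> H"
    and ip_commute: "f \<in> H \<Longrightarrow> g \<in> H \<Longrightarrow> ip f g = ip g f"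
    and ip_add: "f \<in> H \<Longrightarrow> g \<in> H \<Longrightarrow> h \<in> H \<Longrightarrow> ip (\<lambda>x. f x + g x) h = ip f h + ip g h"
    and ip_scale: "f \<in> H \<Longrightarrow> g \<in> H \<Longrightarrow> ip (\<lambda>x. a * f x) g = a * ip f g"
    and ip_nonneg: "f \<in> H \<Longrightarrow> 0 \<le> ip f f"
    and ip_definite: "f \<in> H \<Longrightarrow> ip f f = 0 \<Longrightarrow> f = (\<lambda>_. 0)"
    and complete:
      "(\<And>n. F n \<in> H) \<Longrightarrow>
       (\<And>e. e > 0 \<Longrightarrow> \<exists>N. \<forall>m\<ge>N. \<forall>n\<ge>N.
          sqrt (ip (\<lambda>x. F m x - F n x) (\<lambda>x. F m x - F n x)) < e) \<Longrightarrow>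
       \<exists>f\<in>H. (\<lambda>n. sqrt (ip (\<lambda>x. F n x - f x) (\<lambda>x. F n x - f x))) \<longlonglongrightarrow> 0"
    and section_mem: "x \<in> E \<Longrightarrow> kernel_section E M x \<in> H"
    and reproducing: "f \<in> H \<Longrightarrow> x \<in> E \<Longrightarrow> ip f (kernel_section E M x) = f x"

text \<open>
  By the Moore-Aronszajn theorem, a symmetric positive semidefinite \<open>M\<close> on \<open>E \<times> E\<close> has exactly
  one reproducing kernel Hilbert space (with the inner product determined on \<open>H \<times> H\<close>), so the
  choice below is immaterial.
\<close>

definition rkhs_pair ::
  "'a set \<Rightarrow> ('a \<Rightarrow> 'a \<Rightarrow> real) \<Rightarrow> ('a \<Rightarrow> real) set \<times> (('a \<Rightarrow> real) \<Rightarrow> ('a \<Rightarrow> real) \<Rightarrow> real)" where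
  "rkhs_pair E M = (SOME p. reproducing_kernel_hilbert_space E M (fst p) (snd p))"

definition rkhs :: "'a set \<Rightarrow> ('a \<Rightarrow> 'a \<Rightarrow> real) \<Rightarrow> ('a \<Rightarrow> real) set" where
  "rkhs E M = fst (rkhs_pair E M)"

definition rkhs_norm :: "'a set \<Rightarrow> ('a \<Rightarrow> 'a \<Rightarrow> real) \<Rightarrow> ('a \<Rightarrow> real) \<Rightarrow> real" where
  "rkhs_norm E M f = sqrt (snd (rkhs_pair E M) f f)"

definition rkhs_isometric_isomorphism ::
  "'a set \<Rightarrow> ('a \<Rightarrow> 'a \<Rightarrow> real) \<Rightarrow> 'b set \<Rightarrow> ('b \<Rightarrow> 'b \<Rightarrow> real) \<Rightarrow>
   (('a \<Rightarrow> real) \<Rightarrow> ('b \<Rightarrow> real)) \<Rightarrow> bool" where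
  "rkhs_isometric_isomorphism E M E' M' T \<longleftrightarrow>
     bij_betw T (rkhs E M) (rkhs E' M') \<and>
     (\<forall>f\<in>rkhs E M. \<forall>g\<in>rkhs E M. T (\<lambda>x. f x + g x) = (\<lambda>x. T f x + T g x)) \<and>
     (\<forall>a. \<forall>f\<in>rkhs E M. T (\<lambda>x. a * f x) = (\<lambda>x. a * T f x)) \<and>
     (\<forall>f\<in>rkhs E M. rkhs_norm E' M' (T f) = rkhs_norm E M f)"


subsection \<open>The space of square-integrable functions\<close>

text \<open>
  \<open>L2_fun M\<close> consists of representatives; the elements of the space are their classes with respect
  to equality almost everywhere. A map of the space is given by a map \<open>T\<close> of representatives
  compatible with that equivalence, and equality of values is equality almost everywhere.
\<close>

definition L2_fun :: "'a measure \<Rightarrow> ('a \<Rightarrow> real) set" where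
  "L2_fun M = {f \<in> borel_measurable M. integrable M (\<lambda>x. (f x)\<^sup>2)}"

definition L2_norm :: "'a measure \<Rightarrow> ('a \<Rightarrow> real) \<Rightarrow> real" where
  "L2_norm M f = sqrt (\<integral>x. (f x)\<^sup>2 \<partial>M)"

definition L2_isometric_isomorphism ::
  "'a measure \<Rightarrow> (('a \<Rightarrow> real) \<Rightarrow> ('a \<Rightarrow> real)) \<Rightarrow> bool" where
  "L2_isometric_isomorphism M T \<longleftrightarrow>
     (\<forall>f\<in>L2_fun M. T f \<in> L2_fun M) \<and>
     (\<forall>f\<in>L2_fun M. \<forall>g\<in>L2_fun M. (AE x in M. f x = g x) \<longleftrightarrow> (AE x in M. T f x = T g x)) \<and>
     (\<forall>h\<in>L2_fun M. \<exists>f\<in>L2_fun M. AE x in M. T f x = h x) \<and>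
     (\<forall>f\<in>L2_fun M. \<forall>g\<in>L2_fun M. AE x in M. T (\<lambda>y. f y + g y) x = T f x + T g x) \<and>
     (\<forall>a. \<forall>f\<in>L2_fun M. AE x in M. T (\<lambda>y. a * f y) x = a * T f x) \<and>
     (\<forall>f\<in>L2_fun M. L2_norm M (T f) = L2_norm M f)"


subsection \<open>Gaussian measure, kernels, and the operator\<close>

definition gauss_seq_measure :: "(nat \<Rightarrow> real) measure" where
  "gauss_seq_measure = PiM UNIV (\<lambda>_. density lborel (\<lambda>x. ennreal (std_normal_density x)))"

definition hermite_h :: "nat \<Rightarrow> real \<Rightarrow> real" where
  "hermite_h \<nu> x =
     sqrt (fact \<nu>) *
     (\<Sum>k = 0..\<nu> div 2. (-1) ^ k * (x ^ (\<nu> - 2 * k) / (2 ^ k * fact k * fact (\<nu> - 2 * k))))"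

definition c_coef :: "(nat \<Rightarrow> real) \<Rightarrow> nat \<Rightarrow> real" where
  "c_coef \<sigma> j = (1 + 8 * (\<sigma> j)\<^sup>2) powr (1 / 4)"

definition beta_coef :: "(nat \<Rightarrow> real) \<Rightarrow> nat \<Rightarrow> real" where
  "beta_coef \<sigma> j = 1 - 2 / (1 + (c_coef \<sigma> j)\<^sup>2)"

definition alpha_weight :: "(nat \<Rightarrow> real) \<Rightarrow> nat \<Rightarrow> nat \<Rightarrow> real" where
  "alpha_weight \<sigma> \<nu> j = 1 / ((1 - beta_coef \<sigma> j) * beta_coef \<sigma> j ^ \<nu>)"

definition seq_domain :: "(nat \<Rightarrow> real) \<Rightarrow> (nat \<Rightarrow> real) set" where
  "seq_domain \<sigma> = {x. summable (\<lambda>j. (\<sigma> j)\<^sup>2 * (x j)\<^sup>2)}"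

definition hermite_kernel_1 :: "(nat \<Rightarrow> real) \<Rightarrow> nat \<Rightarrow> real \<Rightarrow> real \<Rightarrow> real" where
  "hermite_kernel_1 \<sigma> j x y =
     (\<Sum>\<nu>. inverse (alpha_weight \<sigma> \<nu> j) * hermite_h \<nu> x * hermite_h \<nu> y)"

definition hermite_kernel :: "(nat \<Rightarrow> real) \<Rightarrow> (nat \<Rightarrow> real) \<Rightarrow> (nat \<Rightarrow> real) \<Rightarrow> real" where
  "hermite_kernel \<sigma> x y = lim_prod (\<lambda>j. hermite_kernel_1 \<sigma> j (x j) (y j))"

definition gauss_kernel_1 :: "(nat \<Rightarrow> real) \<Rightarrow> nat \<Rightarrow> real \<Rightarrow> real \<Rightarrow> real" where
  "gauss_kernel_1 \<sigma> j x y = exp (- ((\<sigma> j)\<^sup>2 * (x - y)\<^sup>2))"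

definition gauss_kernel :: "(nat \<Rightarrow> real) \<Rightarrow> (nat \<Rightarrow> real) \<Rightarrow> (nat \<Rightarrow> real) \<Rightarrow> real" where
  "gauss_kernel \<sigma> x y = lim_prod (\<lambda>j. gauss_kernel_1 \<sigma> j (x j) (y j))"

definition c_star :: "(nat \<Rightarrow> real) \<Rightarrow> real" where
  "c_star \<sigma> = lim_prod (c_coef \<sigma>)"

definition t_map :: "(nat \<Rightarrow> real) \<Rightarrow> (nat \<Rightarrow> real) \<Rightarrow> (nat \<Rightarrow> real)" where
  "t_map \<sigma> x = (\<lambda>j. c_coef \<sigma> j * x j)"

text \<open>
  Off \<open>seq_domain \<sigma>\<close>, a null set when \<open>\<Sum>j. (\<sigma> j)\<^sup>2\<close> converges, \<open>Q_op \<sigma> f\<close> is extended by \<open>0\<close>.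
\<close>

definition Q_op :: "(nat \<Rightarrow> real) \<Rightarrow> ((nat \<Rightarrow> real) \<Rightarrow> real) \<Rightarrow> ((nat \<Rightarrow> real) \<Rightarrow> real)" where
  "Q_op \<sigma> f = (\<lambda>x.
     if x \<in> seq_domain \<sigma>
     then c_star \<sigma> powr (1 / 2) * exp (- (\<Sum>j. ((c_coef \<sigma> j)\<^sup>2 - 1) / 4 * (x j)\<^sup>2)) * f (t_map \<sigma> x)
     else 0)"

end

theory Submission
  imports Defs "HOL-Real_Asymp.Real_Asymp"
begin

text \<open>
  Write \<open>w x = c_star powr (1/2) * exp (- \<Sum>j. (c j ^ 2 - 1) / 4 * x j ^ 2)\<close>, so that
  \<open>Q f = w * (f \<circ> t)\<close> on the domain \<open>X\<close> of sequences with \<open>\<Sum>j. \<sigma> j ^ 2 * x j ^ 2 < \<infinity>\<close>. The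
  map \<open>t\<close> is a bijection of \<open>X\<close>, because \<open>1 \<le> c j\<close> and \<open>c j\<close> is bounded, and \<open>w > 0\<close>. Everything
  follows from two identities for this weighted composition operator.

  The measure \<open>\<mu>\<close> is the image under \<open>t\<close> of the measure with density \<open>w ^ 2\<close> with respect to \<open>\<mu>\<close>
  (\<open>distr_weight_t_map\<close>). In one coordinate this is the substitution \<open>u \<mapsto> c * u\<close> in a Gaussian
  integral. It passes to infinitely many coordinates by dominated convergence, since the partial
  products of the density stay below the finite constant \<open>c_star\<close>. Hence the integral of
  \<open>(Q f) ^ 2\<close> equals that of \<open>f ^ 2\<close>, and \<open>Q\<close> is onto because division by \<open>w\<close> and composition with
  the inverse of \<open>t\<close> undo it.

  The kernels satisfy \<open>L x y = w x * w y * K (t x) (t y)\<close> on \<open>X\<close> (\<open>gauss_kernel_eq\<close>). In one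
  coordinate this is Mehler's formula for the series of products of Hermite polynomials
  (\<open>mehler_formula\<close>); the parameters \<open>c j\<close> and \<open>\<beta> j\<close> are tuned so that the quadratic terms
  match. Weighted composition with a nowhere vanishing weight and a bijection always carries the
  reproducing kernel Hilbert space of \<open>K\<close> isometrically onto that of the transformed kernel
  (\<open>rkhs_weighted_composition\<close>).

  The last fact needs existence and uniqueness of the space with a given kernel. Both come from an
  intrinsic description of its norm: for a finite linear combination \<open>g\<close> of kernel sections, with
  coefficients \<open>a\<close>, the inequality
  \<open>2 * \<langle>f, g\<rangle> - \<parallel>g\<parallel>^2 \<le> \<parallel>f\<parallel>^2\<close> involves only values of \<open>f\<close> and of the kernel on its left-hand side,
  and the supremum of the left-hand sides is \<open>\<parallel>f\<parallel>^2\<close>. So the space consists of the functions for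
  which this supremum, the energy, is finite (\<open>rkhs_eq_finite_energy\<close>).

  Finally, elements of \<open>H(K)\<close> are pointwise limits of combinations of sections and hence
  measurable. Since \<open>L x x = 1\<close>, elements of \<open>H(L)\<close> are bounded, so \<open>H(L)\<close>, which is the image of
  \<open>H(K)\<close> under \<open>Q\<close>, lies in the space of square-integrable functions; the isometry property
  of \<open>Q\<close> pulls this back to \<open>H(K)\<close>.
\<close>

section \<open>Reproducing kernel Hilbert spaces through an energy functional\<close>

text \<open>
  A list of pairs \<open>(c, x)\<close> stands for the functional \<open>f \<mapsto> \<Sum> c * f x\<close>, and also for the combination
  of the kernel sections at the points \<open>x\<close> with coefficients \<open>c\<close>. With lists, addition is
  concatenation, and no bookkeeping of supports is needed.
\<close>

definition pairing :: "(real \<times> 'a) list \<Rightarrow> ('a \<Rightarrow> real) \<Rightarrow> real" where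
  "pairing a f = (\<Sum>(c, x)\<leftarrow>a. c * f x)"

definition scale_comb :: "real \<Rightarrow> (real \<times> 'a) list \<Rightarrow> (real \<times> 'a) list" where
  "scale_comb s a = map (\<lambda>(c, x). (s * c, x)) a"

lemma pairing_Nil [simp]: "pairing [] f = 0"
  and pairing_Cons [simp]: "pairing ((c, x) # a) f = c * f x + pairing a f"
  and pairing_append [simp]: "pairing (a @ b) f = pairing a f + pairing b f"
  by (simp_all add: pairing_def)

lemma pairing_scale_comb [simp]: "pairing (scale_comb s a) f = s * pairing a f"
  by (induction a) (auto simp: scale_comb_def algebra_simps)

lemma pairing_add [simp]: "pairing a (\<lambda>x. f x + g x) = pairing a f + pairing a g"
  and pairing_diff [simp]: "pairing a (\<lambda>x. f x - g x) = pairing a f - pairing a g"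
  and pairing_mult [simp]: "pairing a (\<lambda>x. s * f x) = s * pairing a f"
  and pairing_minus [simp]: "pairing a (\<lambda>x. - f x) = - pairing a f"
  and pairing_zero [simp]: "pairing a (\<lambda>x. 0) = 0"
  by (induction a) (auto simp: algebra_simps)

lemma pairing_cong:
  "a \<in> lists (UNIV \<times> E) \<Longrightarrow> (\<And>x. x \<in> E \<Longrightarrow> f x = g x) \<Longrightarrow> pairing a f = pairing a g"
  by (induction a) auto

lemma tendsto_pairing:
  "a \<in> lists (UNIV \<times> E) \<Longrightarrow> (\<And>x. x \<in> E \<Longrightarrow> (\<lambda>n. f n x) \<longlonglongrightarrow> g x) \<Longrightarrow>
    (\<lambda>n. pairing a (f n)) \<longlonglongrightarrow> pairing a g"
  by (induction a) (auto intro!: tendsto_intros)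

lemma pairing_swap:
  assumes "a \<in> lists (UNIV \<times> E)" "b \<in> lists (UNIV \<times> E)"
    and "\<And>x y. x \<in> E \<Longrightarrow> y \<in> E \<Longrightarrow> M x y = M y x"
  shows "pairing a (\<lambda>x. pairing b (M x)) = pairing b (\<lambda>x. pairing a (M x))"
  using assms(1)
proof (induction a)
  case (Cons p a)
  obtain c x where p: "p = (c, x)" by force
  with Cons have x: "x \<in> E" by auto
  have "pairing b (\<lambda>y. M y x) = pairing b (M x)"
    using assms(2,3) x by (intro pairing_cong[of _ E]) auto
  with Cons show ?case by (simp add: p)
qed simp

locale psd_kernel =
  fixes E :: "'a set" and M :: "'a \<Rightarrow> 'a \<Rightarrow> real"
  assumes sym: "x \<in> E \<Longrightarrow> y \<in> E \<Longrightarrow> M x y = M y x"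
    and psd: "a \<in> lists (UNIV \<times> E) \<Longrightarrow> 0 \<le> pairing a (\<lambda>x. pairing a (M x))"

text \<open>
  With \<open>g = comb E M a\<close>, the reproducing property would give \<open>\<langle>f, g\<rangle> = pairing a f\<close>, so
  \<open>gain M f a\<close> is \<open>2 * \<langle>f, g\<rangle> - \<parallel>g\<parallel>^2 = \<parallel>f\<parallel>^2 - \<parallel>f - g\<parallel>^2\<close>, expressed without an inner product.
  Density of the combinations thus forces the supremum over \<open>a\<close> to be \<open>\<parallel>f\<parallel>^2\<close>.
  The inner product is recovered by polarization.
\<close>

definition comb :: "'a set \<Rightarrow> ('a \<Rightarrow> 'a \<Rightarrow> real) \<Rightarrow> (real \<times> 'a) list \<Rightarrow> 'a \<Rightarrow> real" where
  "comb E M a = (\<lambda>y. if y \<in> E then pairing a (M y) else 0)"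

definition gain :: "('a \<Rightarrow> 'a \<Rightarrow> real) \<Rightarrow> ('a \<Rightarrow> real) \<Rightarrow> (real \<times> 'a) list \<Rightarrow> real" where
  "gain M f a = 2 * pairing a f - pairing a (\<lambda>x. pairing a (M x))"

definition energy :: "'a set \<Rightarrow> ('a \<Rightarrow> 'a \<Rightarrow> real) \<Rightarrow> ('a \<Rightarrow> real) \<Rightarrow> real" where
  "energy E M f = (SUP a\<in>lists (UNIV \<times> E). gain M f a)"

definition finite_energy :: "'a set \<Rightarrow> ('a \<Rightarrow> 'a \<Rightarrow> real) \<Rightarrow> ('a \<Rightarrow> real) set" where
  "finite_energy E M =
    {f. (\<forall>x. x \<notin> E \<longrightarrow> f x = 0) \<and> bdd_above (gain M f ` lists (UNIV \<times> E))}"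

definition energy_ip :: "'a set \<Rightarrow> ('a \<Rightarrow> 'a \<Rightarrow> real) \<Rightarrow> ('a \<Rightarrow> real) \<Rightarrow> ('a \<Rightarrow> real) \<Rightarrow> real" where
  "energy_ip E M f g =
    (energy E M (\<lambda>x. f x + g x) - energy E M (\<lambda>x. f x - g x)) / 4"

lemma scale_comb_in_lists: "a \<in> lists (UNIV \<times> E) \<Longrightarrow> scale_comb s a \<in> lists (UNIV \<times> E)"
  by (auto simp: scale_comb_def)

lemma finite_energyI:
  "(\<And>x. x \<notin> E \<Longrightarrow> f x = 0) \<Longrightarrow> (\<And>a. a \<in> lists (UNIV \<times> E) \<Longrightarrow> gain M f a \<le> B) \<Longrightarrow>
    f \<in> finite_energy E M"
  unfolding finite_energy_def by (auto intro!: bdd_aboveI2)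

lemma energy_le:
  "(\<And>a. a \<in> lists (UNIV \<times> E) \<Longrightarrow> gain M f a \<le> B) \<Longrightarrow> energy E M f \<le> B"
  unfolding energy_def by (rule cSUP_least) auto

lemma gain_le_energy:
  "f \<in> finite_energy E M \<Longrightarrow> a \<in> lists (UNIV \<times> E) \<Longrightarrow> gain M f a \<le> energy E M f"
  unfolding energy_def finite_energy_def by (auto intro: cSUP_upper)

lemma energy_nonneg: "f \<in> finite_energy E M \<Longrightarrow> 0 \<le> energy E M f"
  using gain_le_energy[of f E M "[]"] by (simp add: gain_def)

lemma finite_energy_outside: "f \<in> finite_energy E M \<Longrightarrow> x \<notin> E \<Longrightarrow> f x = 0"
  by (auto simp: finite_energy_def)

lemma gain_scale_comb:
  "gain M (\<lambda>x. s * f x) (scale_comb s a) = s\<^sup>2 * gain M f a"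
  by (simp add: gain_def power2_eq_square algebra_simps)

context psd_kernel
begin

abbreviation "\<L> \<equiv> lists (UNIV \<times> E) :: (real \<times> 'a) list set"
abbreviation "\<H> \<equiv> finite_energy E M"
abbreviation "\<E> \<equiv> energy E M"

lemma gain_scale_le:
  assumes f: "f \<in> \<H>" and a: "a \<in> \<L>"
  shows "gain M (\<lambda>x. s * f x) a \<le> s\<^sup>2 * \<E> f"
proof (cases "s = 0")
  case True
  then show ?thesis using psd[OF a] by (simp add: gain_def)
next
  case False
  have "a = scale_comb s (scale_comb (1 / s) a)"
    using False by (simp add: scale_comb_def comp_def case_prod_unfold)
  then have "gain M (\<lambda>x. s * f x) a = s\<^sup>2 * gain M f (scale_comb (1 / s) a)"
    using gain_scale_comb by metis
  also have "\<dots> \<le> s\<^sup>2 * \<E> f"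
    using f a by (intro mult_left_mono gain_le_energy scale_comb_in_lists) auto
  finally show ?thesis .
qed

lemma scale_finite_energy: "f \<in> \<H> \<Longrightarrow> (\<lambda>x. s * f x) \<in> \<H>"
  by (rule finite_energyI[OF _ gain_scale_le]) (auto dest: finite_energy_outside)

lemma energy_scale:
  assumes f: "f \<in> \<H>"
  shows "\<E> (\<lambda>x. s * f x) = s\<^sup>2 * \<E> f"
proof (rule antisym)
  show "\<E> (\<lambda>x. s * f x) \<le> s\<^sup>2 * \<E> f"
    using f by (intro energy_le gain_scale_le)
  show "s\<^sup>2 * \<E> f \<le> \<E> (\<lambda>x. s * f x)"
  proof (cases "s = 0")
    case True
    then show ?thesis using energy_nonneg[OF scale_finite_energy[OF f, of 0]] by simp
  next
    case False
    have "\<E> (\<lambda>x. (1 / s) * (s * f x)) \<le> (1 / s)\<^sup>2 * \<E> (\<lambda>x. s * f x)"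
      using f by (intro energy_le gain_scale_le scale_finite_energy)
    then have "s\<^sup>2 * \<E> f \<le> s\<^sup>2 * ((1 / s)\<^sup>2 * \<E> (\<lambda>x. s * f x))"
      using False by (intro mult_left_mono) auto
    with False show ?thesis by (simp add: power2_eq_square)
  qed
qed

lemma zero_finite_energy [simp]: "(\<lambda>x. 0) \<in> \<H>"
  and energy_zero [simp]: "\<E> (\<lambda>x. 0) = 0"
proof -
  show *: "(\<lambda>x. 0) \<in> \<H>"
    by (rule finite_energyI[of _ _ _ 0]) (use psd in \<open>auto simp: gain_def\<close>)
  show "\<E> (\<lambda>x. 0) = 0"
    using energy_scale[OF *, of 0] by simp
qed

text \<open>
  Splitting the quadratic term in the ratio \<open>1 : d\<close> bounds the energy of a sum by a weighted sum of
  energies. The free parameter \<open>d\<close> is optimized in the triangle inequality below.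
\<close>

lemma gain_add_le:
  assumes f: "f \<in> \<H>" and g: "g \<in> \<H>" and a: "a \<in> \<L>" and d: "d > 0"
  shows "gain M (\<lambda>x. f x + g x) a \<le> (1 + d) * \<E> f + (1 + 1 / d) * \<E> g"
proof -
  have "gain M (\<lambda>x. f x + g x) a =
      1 / (1 + d) * gain M (\<lambda>x. (1 + d) * f x) a + d / (1 + d) * gain M (\<lambda>x. (1 + 1 / d) * g x) a"
    using d unfolding gain_def pairing_add pairing_mult
    by (simp add: divide_simps) (simp add: algebra_simps)
  also have "\<dots> \<le> 1 / (1 + d) * ((1 + d)\<^sup>2 * \<E> f) + d / (1 + d) * ((1 + 1 / d)\<^sup>2 * \<E> g)"
    using d f g a by (intro add_mono mult_left_mono gain_scale_le) auto
  also have "\<dots> = (1 + d) * \<E> f + (1 + 1 / d) * \<E> g"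
    using d by (simp add: divide_simps power2_eq_square) (simp add: algebra_simps)
  finally show ?thesis .
qed

lemma add_finite_energy: "f \<in> \<H> \<Longrightarrow> g \<in> \<H> \<Longrightarrow> (\<lambda>x. f x + g x) \<in> \<H>"
  by (rule finite_energyI[OF _ gain_add_le[of _ _ _ 1]]) (auto simp: finite_energy_outside)

lemma diff_finite_energy: "f \<in> \<H> \<Longrightarrow> g \<in> \<H> \<Longrightarrow> (\<lambda>x. f x - g x) \<in> \<H>"
  using add_finite_energy[OF _ scale_finite_energy[of g "-1"]] by simp

lemma energy_minus: "g \<in> \<H> \<Longrightarrow> f \<in> \<H> \<Longrightarrow> \<E> (\<lambda>x. g x - f x) = \<E> (\<lambda>x. f x - g x)"
  using energy_scale[of "\<lambda>x. f x - g x" "-1"] diff_finite_energy by simp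

lemma sqrt_energy_triangle:
  assumes f: "f \<in> \<H>" and g: "g \<in> \<H>"
  shows "sqrt (\<E> (\<lambda>x. f x + g x)) \<le> sqrt (\<E> f) + sqrt (\<E> g)"
proof (rule field_le_epsilon)
  fix e :: real assume e: "e > 0"
  \<comment> \<open>The optimal parameter is the quotient of the norms; adding \<open>e / 2\<close> keeps it defined when a norm vanishes.\<close>
  define A where "A = sqrt (\<E> f) + e / 2"
  define B where "B = sqrt (\<E> g) + e / 2"
  have pos: "A > 0" "B > 0" and le: "\<E> f \<le> A\<^sup>2" "\<E> g \<le> B\<^sup>2"
    using e energy_nonneg[OF f] energy_nonneg[OF g]
    by (auto simp: A_def B_def add_nonneg_pos intro!: sqrt_le_D)
  have "\<E> (\<lambda>x. f x + g x) \<le> (1 + B / A) * \<E> f + (1 + 1 / (B / A)) * \<E> g"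
    using f g pos by (intro energy_le gain_add_le) auto
  also have "\<dots> \<le> (1 + B / A) * A\<^sup>2 + (1 + 1 / (B / A)) * B\<^sup>2"
    using pos le by (intro add_mono mult_left_mono) auto
  also have "\<dots> = (A + B)\<^sup>2"
    using pos by (simp add: field_simps power2_eq_square)
  finally show "sqrt (\<E> (\<lambda>x. f x + g x)) \<le> sqrt (\<E> f) + sqrt (\<E> g) + e"
    using pos by (simp add: real_le_lsqrt A_def B_def algebra_simps)
qed

lemma comb_form:
  "b \<in> \<L> \<Longrightarrow> pairing b (comb E M a) = pairing b (\<lambda>x. pairing a (M x))"
  by (rule pairing_cong) (auto simp: comb_def)

lemma comb_append: "comb E M (a @ b) = (\<lambda>x. comb E M a x + comb E M b x)"
  and comb_scale: "comb E M (scale_comb s a) = (\<lambda>x. s * comb E M a x)"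
  by (auto simp: comb_def)

text \<open>
  Completing the square: adding the combination \<open>a\<close> to \<open>f\<close> amounts to subtracting \<open>a\<close> from the test
  combination. As the test combinations form a vector space, the supremum is only shifted by a
  constant. This computes energies of \<open>f \<plusminus> comb E M a\<close> exactly, from which the reproducing property
  and the density of the combinations follow.
\<close>

lemma gain_add_comb:
  assumes a: "a \<in> \<L>" and b: "b \<in> \<L>"
  shows "gain M (\<lambda>x. f x + comb E M a x) b =
    gain M f (b @ scale_comb (-1) a) + 2 * pairing a f + pairing a (comb E M a)"
proof -
  have "pairing b (\<lambda>x. pairing a (M x)) = pairing a (\<lambda>x. pairing b (M x))"
    using b a sym by (rule pairing_swap)
  then show ?thesis
    using pairing_diff[of _ "\<lambda>x. pairing a (M x)" "\<lambda>x. pairing b (M x)"]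
    by (simp add: gain_def comb_form[OF a] comb_form[OF b] flip: minus_mult_left)
qed

lemma gain_add_comb_le:
  assumes f: "f \<in> \<H>" and a: "a \<in> \<L>" and b: "b \<in> \<L>"
  shows "gain M (\<lambda>x. f x + comb E M a x) b \<le> \<E> f + 2 * pairing a f + pairing a (comb E M a)"
  unfolding gain_add_comb[OF a b]
  using gain_le_energy[OF f, of "b @ scale_comb (-1) a"] a b scale_comb_in_lists[OF a] by auto

lemma add_comb_finite_energy: "f \<in> \<H> \<Longrightarrow> a \<in> \<L> \<Longrightarrow> (\<lambda>x. f x + comb E M a x) \<in> \<H>"
  by (rule finite_energyI[OF _ gain_add_comb_le]) (auto simp: comb_def finite_energy_outside)

lemma comb_finite_energy [simp]: "a \<in> \<L> \<Longrightarrow> comb E M a \<in> \<H>"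
  using add_comb_finite_energy[OF zero_finite_energy] by simp

lemma energy_add_comb:
  assumes f: "f \<in> \<H>" and a: "a \<in> \<L>"
  shows "\<E> (\<lambda>x. f x + comb E M a x) = \<E> f + 2 * pairing a f + pairing a (comb E M a)"
proof (rule antisym)
  show "\<E> (\<lambda>x. f x + comb E M a x) \<le> \<E> f + 2 * pairing a f + pairing a (comb E M a)"
    using f a by (intro energy_le gain_add_comb_le)
  let ?g = "\<lambda>x. f x + comb E M a x"
  have "\<E> (\<lambda>x. ?g x + comb E M (scale_comb (-1) a) x) \<le>
      \<E> ?g + 2 * pairing (scale_comb (-1) a) ?g
        + pairing (scale_comb (-1) a) (comb E M (scale_comb (-1) a))"
    using f a by (intro energy_le gain_add_comb_le add_comb_finite_energy scale_comb_in_lists)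
  then show "\<E> f + 2 * pairing a f + pairing a (comb E M a) \<le> \<E> ?g"
    by (simp add: comb_scale flip: minus_mult_left)
qed

lemma energy_diff_comb:
  assumes f: "f \<in> \<H>" and a: "a \<in> \<L>"
  shows "\<E> (\<lambda>x. f x - comb E M a x) = \<E> f - gain M f a"
  using energy_add_comb[OF f scale_comb_in_lists[OF a, of "-1"]]
  by (simp add: comb_scale gain_def comb_form[OF a] flip: minus_mult_left)

lemma energy_comb: "a \<in> \<L> \<Longrightarrow> \<E> (comb E M a) = pairing a (comb E M a)"
  using energy_add_comb[OF zero_finite_energy] by simp

lemma energy_ip_comb:
  assumes f: "f \<in> \<H>" and a: "a \<in> \<L>"
  shows "energy_ip E M f (comb E M a) = pairing a f"
  unfolding energy_ip_def energy_add_comb[OF f a] energy_diff_comb[OF f a]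
  by (simp add: gain_def comb_form[OF a])

text \<open>
  Combinations whose gain is close to the supremum are close to \<open>f\<close>, since by \<open>energy_diff_comb\<close> the
  difference between energy and gain is the energy of \<open>f - comb E M a\<close>.
\<close>

lemma energy_approx:
  assumes f: "f \<in> \<H>"
  shows "\<exists>a. (\<forall>n. a n \<in> \<L>) \<and> (\<lambda>n. \<E> (\<lambda>x. f x - comb E M (a n) x)) \<longlonglongrightarrow> 0"
proof -
  have "\<exists>a\<in>\<L>. \<E> f - inverse (real (Suc n)) < gain M f a" for n
  proof -
    have "\<E> f - inverse (real (Suc n)) < (SUP a\<in>\<L>. gain M f a)"
      by (simp add: energy_def)
    then show ?thesis
      using f by (subst (asm) less_cSUP_iff) (auto simp: finite_energy_def)
  qed
  then obtain a where a: "\<And>n. a n \<in> \<L>" "\<And>n. \<E> f - inverse (real (Suc n)) < gain M f (a n)"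
    by metis
  show ?thesis
  proof (intro exI conjI allI)
    show "a n \<in> \<L>" for n by (rule a)
    show "(\<lambda>n. \<E> (\<lambda>x. f x - comb E M (a n) x)) \<longlonglongrightarrow> 0"
    proof (rule tendsto_sandwich[OF _ _ tendsto_const LIMSEQ_inverse_real_of_nat])
      show "\<forall>\<^sub>F n in sequentially. 0 \<le> \<E> (\<lambda>x. f x - comb E M (a n) x)"
        using a f by (auto intro!: always_eventually energy_nonneg diff_finite_energy)
      show "\<forall>\<^sub>F n in sequentially. \<E> (\<lambda>x. f x - comb E M (a n) x) \<le> inverse (real (Suc n))"
        unfolding energy_diff_comb[OF f a(1)]
        using a(2) by (intro always_eventually allI) (smt (verit))
    qed
  qed
qed

lemma energy_continuous:
  assumes f: "f \<in> \<H>" and F: "\<And>n. F n \<in> \<H>"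
    and lim: "(\<lambda>n. \<E> (\<lambda>x. f x - F n x)) \<longlonglongrightarrow> 0"
  shows "(\<lambda>n. \<E> (F n)) \<longlonglongrightarrow> \<E> f"
proof -
  have tri: "sqrt (\<E> g) \<le> sqrt (\<E> h) + sqrt (\<E> (\<lambda>x. g x - h x))" if "g \<in> \<H>" "h \<in> \<H>" for g h
    using sqrt_energy_triangle[OF that(2) diff_finite_energy[OF that]] by simp
  have "(\<lambda>n. sqrt (\<E> (F n))) \<longlonglongrightarrow> sqrt (\<E> f)"
  proof (rule LIM_zero_cancel, rule Lim_null_comparison)
    show "(\<lambda>n. sqrt (\<E> (\<lambda>x. f x - F n x))) \<longlonglongrightarrow> 0"
      using tendsto_real_sqrt[OF lim] by simp
    show "\<forall>\<^sub>F n in sequentially. norm (sqrt (\<E> (F n)) - sqrt (\<E> f)) \<le> sqrt (\<E> (\<lambda>x. f x - F n x))"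
      using tri[OF f F] tri[OF F f] energy_minus[OF F f]
      by (intro always_eventually allI) (simp add: abs_le_iff algebra_simps)
  qed
  from tendsto_power[OF this, of 2] show ?thesis
    using energy_nonneg[OF f] energy_nonneg[OF F] by simp
qed

text \<open>
  The polarization formula is not visibly additive. But along approximations of \<open>g\<close> by combinations
  it is a limit of the pairings with \<open>f\<close>, which are linear in \<open>f\<close>; so bilinearity needs no separate
  argument from the parallelogram law.
\<close>

lemma ip_limit:
  assumes f: "f \<in> \<H>" and g: "g \<in> \<H>" and a: "\<And>n. a n \<in> \<L>"
    and lim: "(\<lambda>n. \<E> (\<lambda>x. g x - comb E M (a n) x)) \<longlonglongrightarrow> 0"
  shows "(\<lambda>n. pairing (a n) f) \<longlonglongrightarrow> energy_ip E M f g"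
proof -
  have "(\<lambda>n. energy_ip E M f (comb E M (a n))) \<longlonglongrightarrow> energy_ip E M f g"
    unfolding energy_ip_def
  proof (intro tendsto_intros)
    show "(\<lambda>n. \<E> (\<lambda>x. f x + comb E M (a n) x)) \<longlonglongrightarrow> \<E> (\<lambda>x. f x + g x)"
      using f g a lim by (intro energy_continuous add_finite_energy) auto
    show "(\<lambda>n. \<E> (\<lambda>x. f x - comb E M (a n) x)) \<longlonglongrightarrow> \<E> (\<lambda>x. f x - g x)"
      using f g a lim energy_minus[OF g, of "comb E M (a _)"]
      by (intro energy_continuous diff_finite_energy) auto
  qed auto
  then show ?thesis by (simp add: energy_ip_comb[OF f a])
qed

lemma ip_self: "f \<in> \<H> \<Longrightarrow> energy_ip E M f f = \<E> f"
  using energy_scale[of f 2] by (simp add: energy_ip_def)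

lemma point_le_energy:
  assumes f: "f \<in> \<H>" and x: "x \<in> E"
  shows "(f x)\<^sup>2 \<le> \<E> f * M x x"
proof (cases "M x x = 0")
  case True
  have *: "2 * s * f x \<le> \<E> f" for s
    using gain_le_energy[OF f, of "[(s, x)]"] x True by (simp add: gain_def)
  have "f x = 0"
  proof (rule ccontr)
    assume "f x \<noteq> 0"
    with *[of "(\<E> f + 1) / (2 * f x)"] show False by simp
  qed
  with True show ?thesis by simp
next
  case False
  then have pos: "M x x > 0"
    using psd[of "[(1, x)]"] x by simp
  \<comment> \<open>The coefficient \<open>f x / M x x\<close> maximizes the gain over multiples of the section at \<open>x\<close>.\<close>
  have "gain M f [(f x / M x x, x)] = (f x)\<^sup>2 / M x x"
    using pos by (simp add: gain_def power2_eq_square field_simps)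
  with gain_le_energy[OF f, of "[(f x / M x x, x)]"] x pos show ?thesis
    by (simp add: field_simps)
qed

lemma energy_eq_0_iff:
  assumes f: "f \<in> \<H>"
  shows "\<E> f = 0 \<longleftrightarrow> f = (\<lambda>_. 0)"
proof
  assume "\<E> f = 0"
  with point_le_energy[OF f] finite_energy_outside[OF f] show "f = (\<lambda>_. 0)"
    by (metis ext mult_zero_left power2_less_eq_zero_iff)
qed simp

text \<open>
  A Cauchy sequence converges pointwise by \<open>point_le_energy\<close>. Each gain depends on finitely many
  values only, so it is continuous under pointwise convergence, and bounds on energies pass to the
  limit.
\<close>

lemma finite_energy_complete:
  assumes F: "\<And>n. F n \<in> \<H>"
    and Cauchy: "\<And>e. e > 0 \<Longrightarrow> \<exists>N. \<forall>m\<ge>N. \<forall>n\<ge>N. sqrt (\<E> (\<lambda>x. F m x - F n x)) < e"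
  shows "\<exists>f\<in>\<H>. (\<lambda>n. sqrt (\<E> (\<lambda>x. F n x - f x))) \<longlonglongrightarrow> 0"
proof -
  have pt: "\<bar>F m x - F n x\<bar> \<le> sqrt (\<E> (\<lambda>x. F m x - F n x)) * sqrt (M x x)" if "x \<in> E" for m n x
    using real_sqrt_le_mono[OF point_le_energy[OF diff_finite_energy[OF F F] that]]
    by (simp add: real_sqrt_mult)
  have "convergent (\<lambda>n. F n x)" for x
  proof (cases "x \<in> E")
    case True
    define C where "C = sqrt (M x x) + 1"
    have C: "C > 0" "sqrt (M x x) \<le> C"
      using psd[of "[(1, x)]"] True by (auto simp: C_def add_nonneg_pos)
    have "Cauchy (\<lambda>n. F n x)"
    proof (rule metric_CauchyI)
      fix e :: real assume "e > 0"
      with C Cauchy[of "e / C"] obtain N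
        where N: "\<And>m n. m \<ge> N \<Longrightarrow> n \<ge> N \<Longrightarrow> sqrt (\<E> (\<lambda>x. F m x - F n x)) < e / C"
        by auto
      have "dist (F m x) (F n x) < e" if "m \<ge> N" "n \<ge> N" for m n
      proof -
        have "\<bar>F m x - F n x\<bar> \<le> sqrt (\<E> (\<lambda>x. F m x - F n x)) * C"
          using pt[OF True, of m n] C energy_nonneg[OF diff_finite_energy[OF F F], of m n]
          by (meson mult_left_mono order_trans real_sqrt_ge_zero)
        also have "\<dots> < e"
          using N[OF that] C by (simp add: field_simps)
        finally show ?thesis by (simp add: dist_real_def)
      qed
      then show "\<exists>N. \<forall>m\<ge>N. \<forall>n\<ge>N. dist (F m x) (F n x) < e" by blast
    qed
    then show ?thesis by (rule Cauchy_convergent)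
  next
    case False
    then show ?thesis using finite_energy_outside[OF F False] by (simp add: convergent_const)
  qed
  then obtain f where f: "\<And>x. (\<lambda>n. F n x) \<longlonglongrightarrow> f x"
    unfolding convergent_def by metis
  have f0: "f x = 0" if "x \<notin> E" for x
    using f[of x] finite_energy_outside[OF F that] by (simp add: LIMSEQ_const_iff)
  have bound: "gain M (\<lambda>x. F n x - f x) a \<le> e\<^sup>2"
    if e: "e > 0" and N: "\<And>m n. m \<ge> N \<Longrightarrow> n \<ge> N \<Longrightarrow> sqrt (\<E> (\<lambda>x. F m x - F n x)) < e"
      and n: "n \<ge> N" and a: "a \<in> \<L>" for e N n a
  proof (rule LIMSEQ_le_const2)
    show "(\<lambda>m. gain M (\<lambda>x. F n x - F m x) a) \<longlonglongrightarrow> gain M (\<lambda>x. F n x - f x) a"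
      unfolding gain_def using f by (intro tendsto_intros tendsto_pairing[OF a]) auto
    have "gain M (\<lambda>x. F n x - F m x) a \<le> e\<^sup>2" if "m \<ge> N" for m
    proof -
      have "gain M (\<lambda>x. F n x - F m x) a \<le> \<E> (\<lambda>x. F n x - F m x)"
        using F a by (intro gain_le_energy diff_finite_energy)
      also have "\<dots> \<le> e\<^sup>2"
        using N[OF n that] e by (intro sqrt_le_D) auto
      finally show ?thesis .
    qed
    then show "\<exists>N. \<forall>m\<ge>N. gain M (\<lambda>x. F n x - F m x) a \<le> e\<^sup>2" by blast
  qed
  have diff: "(\<lambda>x. F n x - f x) \<in> \<H>"
    if e: "e > 0" and N: "\<And>m n. m \<ge> N \<Longrightarrow> n \<ge> N \<Longrightarrow> sqrt (\<E> (\<lambda>x. F m x - F n x)) < e"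
      and n: "n \<ge> N" for e N n
    using finite_energyI[OF _ bound[OF e N n]] f0 finite_energy_outside[OF F] by auto
  obtain N where N: "\<And>m n. m \<ge> N \<Longrightarrow> n \<ge> N \<Longrightarrow> sqrt (\<E> (\<lambda>x. F m x - F n x)) < 1"
    using Cauchy[of 1] by auto
  have "f \<in> \<H>"
    using diff_finite_energy[OF F[of N] diff[of 1 N N]] N by simp
  moreover have "(\<lambda>n. sqrt (\<E> (\<lambda>x. F n x - f x))) \<longlonglongrightarrow> 0"
  proof (rule LIMSEQ_I)
    fix r :: real assume r: "r > 0"
    then obtain N where N: "\<And>m n. m \<ge> N \<Longrightarrow> n \<ge> N \<Longrightarrow> sqrt (\<E> (\<lambda>x. F m x - F n x)) < r / 2"
      using Cauchy[of "r / 2"] by auto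
    have "norm (sqrt (\<E> (\<lambda>x. F n x - f x)) - 0) < r" if n: "n \<ge> N" for n
    proof -
      have "\<E> (\<lambda>x. F n x - f x) \<le> (r / 2)\<^sup>2"
        using r by (intro energy_le bound[OF _ N n]) auto
      then have "sqrt (\<E> (\<lambda>x. F n x - f x)) \<le> r / 2"
        using r by (intro real_le_lsqrt) auto
      moreover have "0 \<le> \<E> (\<lambda>x. F n x - f x)"
        using energy_nonneg[OF diff[OF _ N n]] r by simp
      ultimately show ?thesis using r by simp
    qed
    then show "\<exists>N. \<forall>n\<ge>N. norm (sqrt (\<E> (\<lambda>x. F n x - f x)) - 0) < r" by blast
  qed
  ultimately show ?thesis by blast
qed

lemma kernel_section_eq_comb: "kernel_section E M x = comb E M [(1, x)]"
  by (auto simp: kernel_section_def comb_def)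

text \<open>
  Existence of the space with kernel \<open>M\<close> (Moore-Aronszajn).
\<close>

theorem rkhs_finite_energy:
  "reproducing_kernel_hilbert_space E M \<H> (energy_ip E M)"
proof
  fix f g h assume f: "f \<in> \<H>" and g: "g \<in> \<H>" and h: "h \<in> \<H>"
  obtain a where a: "\<And>n. a n \<in> \<L>" "(\<lambda>n. \<E> (\<lambda>x. h x - comb E M (a n) x)) \<longlonglongrightarrow> 0"
    using energy_approx[OF h] by blast
  note L = ip_limit[OF _ h a]
  show "energy_ip E M (\<lambda>x. f x + g x) h = energy_ip E M f h + energy_ip E M g h"
    using LIMSEQ_unique[OF L[OF add_finite_energy[OF f g]]] tendsto_add[OF L[OF f] L[OF g]] by simp
next
  fix f g s assume f: "f \<in> \<H>" and g: "g \<in> \<H>"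
  obtain a where a: "\<And>n. a n \<in> \<L>" "(\<lambda>n. \<E> (\<lambda>x. g x - comb E M (a n) x)) \<longlonglongrightarrow> 0"
    using energy_approx[OF g] by blast
  note L = ip_limit[OF _ g a]
  show "energy_ip E M (\<lambda>x. s * f x) g = s * energy_ip E M f g"
    using LIMSEQ_unique[OF L[OF scale_finite_energy[OF f, of s]]] tendsto_mult_left[OF L[OF f], of s]
    by simp
next
  fix f g assume "f \<in> \<H>" "g \<in> \<H>"
  then show "energy_ip E M f g = energy_ip E M g f"
    using energy_minus[of f g] by (simp add: energy_ip_def add.commute)
next
  fix F :: "nat \<Rightarrow> 'a \<Rightarrow> real"
  assume F: "\<And>n. F n \<in> \<H>"
  have self: "energy_ip E M (\<lambda>x. F m x - g x) (\<lambda>x. F m x - g x) = \<E> (\<lambda>x. F m x - g x)"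
    if "g \<in> \<H>" for m g
    using F that by (intro ip_self diff_finite_energy)
  assume "\<And>e. e > 0 \<Longrightarrow> \<exists>N. \<forall>m\<ge>N. \<forall>n\<ge>N.
    sqrt (energy_ip E M (\<lambda>x. F m x - F n x) (\<lambda>x. F m x - F n x)) < e"
  then show "\<exists>f\<in>\<H>. (\<lambda>n. sqrt (energy_ip E M (\<lambda>x. F n x - f x) (\<lambda>x. F n x - f x))) \<longlonglongrightarrow> 0"
    using finite_energy_complete[OF F] by (simp add: self F cong: bex_cong)
next
  fix f x assume "f \<in> \<H>" "x \<in> E"
  then show "energy_ip E M f (kernel_section E M x) = f x"
    by (simp add: kernel_section_eq_comb energy_ip_comb)
qed (auto simp: ip_self energy_nonneg energy_eq_0_iff kernel_section_eq_comb
  intro: finite_energy_outside add_finite_energy scale_finite_energy)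

lemma finite_energy_pointwise_limit_of_combs:
  assumes f: "f \<in> \<H>"
  shows "\<exists>a. (\<forall>n. a n \<in> \<L>) \<and> (\<forall>x. (\<lambda>n. comb E M (a n) x) \<longlonglongrightarrow> f x)"
proof -
  obtain a where a: "\<And>n. a n \<in> \<L>" "(\<lambda>n. \<E> (\<lambda>x. f x - comb E M (a n) x)) \<longlonglongrightarrow> 0"
    using energy_approx[OF f] by blast
  have "(\<lambda>n. comb E M (a n) x) \<longlonglongrightarrow> f x" for x
  proof (cases "x \<in> E")
    case True
    have "(\<lambda>n. (f x - comb E M (a n) x)\<^sup>2) \<longlonglongrightarrow> 0"
    proof (rule Lim_null_comparison)
      show "\<forall>\<^sub>F n in sequentially. norm ((f x - comb E M (a n) x)\<^sup>2)
          \<le> \<E> (\<lambda>x. f x - comb E M (a n) x) * M x x"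
        using point_le_energy[OF diff_finite_energy[OF f comb_finite_energy[OF a(1)]] True] by simp
      show "(\<lambda>n. \<E> (\<lambda>x. f x - comb E M (a n) x) * M x x) \<longlonglongrightarrow> 0"
        using tendsto_mult_right[OF a(2)] by simp
    qed
    from tendsto_real_sqrt[OF this] have "(\<lambda>n. f x - comb E M (a n) x) \<longlonglongrightarrow> 0"
      by (simp add: tendsto_rabs_zero_iff)
    from tendsto_diff[OF tendsto_const[of "f x"] this] show ?thesis by simp
  next
    case False
    then show ?thesis using finite_energy_outside[OF f False] by (simp add: comb_def)
  qed
  with a(1) show ?thesis by blast
qed

end

context reproducing_kernel_hilbert_space
begin

lemma diff_mem: "f \<in> H \<Longrightarrow> g \<in> H \<Longrightarrow> (\<lambda>x. f x - g x) \<in> H"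
  using add_mem[OF _ scale_mem[of g "-1"]] by simp

lemma comb_Cons:
  "comb E M ((c, x) # a) = (\<lambda>y. c * kernel_section E M x y + comb E M a y)"
  by (auto simp: comb_def kernel_section_def)

lemma comb_mem: "a \<in> lists (UNIV \<times> E) \<Longrightarrow> comb E M a \<in> H"
proof (induction a)
  case Nil
  then show ?case using zero_mem by (simp add: comb_def if_distrib cong: if_cong)
next
  case (Cons p a)
  then show ?case
    by (cases p) (auto simp: comb_Cons intro!: add_mem scale_mem section_mem)
qed

lemma ip_comb: "a \<in> lists (UNIV \<times> E) \<Longrightarrow> f \<in> H \<Longrightarrow> ip f (comb E M a) = pairing a f"
proof (induction a)
  case Nil
  have "comb E M [] = (\<lambda>x. 0)" by (auto simp: comb_def)
  with Nil show ?case
    using zero_mem ip_scale[of "\<lambda>x. 0" f 0] ip_commute[of "\<lambda>x. 0" f] by auto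
next
  case (Cons p a)
  obtain c x where p: "p = (c, x)" by force
  with Cons.prems have x: "x \<in> E" and a: "a \<in> lists (UNIV \<times> E)" and f: "f \<in> H" by auto
  note mem = scale_mem[OF section_mem[OF x], of c] comb_mem[OF a]
  have "ip f (comb E M (p # a)) = ip (\<lambda>y. c * kernel_section E M x y + comb E M a y) f"
    unfolding p comb_Cons by (intro ip_commute f add_mem mem)
  also have "\<dots> = c * ip f (kernel_section E M x) + ip f (comb E M a)"
    using ip_add[OF mem f] ip_scale[OF section_mem[OF x] f, of c]
      ip_commute[OF f section_mem[OF x]] ip_commute[OF f mem(2)] by simp
  also have "\<dots> = pairing (p # a) f"
    using f x Cons.IH[OF a f] by (simp add: reproducing p)
  finally show ?case .
qed

lemma psd_kernel: "psd_kernel E M"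
proof
  fix x y assume x: "x \<in> E" and y: "y \<in> E"
  show "M x y = M y x"
    using ip_commute[OF section_mem[OF x] section_mem[OF y]]
      reproducing[OF section_mem[OF x] y] reproducing[OF section_mem[OF y] x] x y
    by (simp add: kernel_section_def)
next
  fix a :: "(real \<times> 'a) list" assume a: "a \<in> lists (UNIV \<times> E)"
  have "pairing a (comb E M a) = pairing a (\<lambda>x. pairing a (M x))"
    using a by (rule pairing_cong) (simp add: comb_def)
  with ip_nonneg[OF comb_mem[OF a]] ip_comb[OF a comb_mem[OF a]]
  show "0 \<le> pairing a (\<lambda>x. pairing a (M x))" by simp
qed

sublocale psd_kernel E M by (rule psd_kernel)

lemma ip_diff_comb:
  assumes f: "f \<in> H" and a: "a \<in> lists (UNIV \<times> E)"
  shows "ip (\<lambda>x. f x - comb E M a x) (\<lambda>x. f x - comb E M a x) = ip f f - gain M f a"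
proof -
  let ?b = "scale_comb (-1) a"
  let ?d = "\<lambda>x. f x + comb E M ?b x"
  have b: "?b \<in> lists (UNIV \<times> E)" using a by (rule scale_comb_in_lists)
  have d: "?d \<in> H" using f comb_mem[OF b] by (rule add_mem)
  have "ip ?d ?d = ip ?d f + pairing ?b ?d"
    using ip_add[OF f comb_mem[OF b] d] ip_commute[OF f d]
      ip_commute[OF comb_mem[OF b] d] ip_comb[OF b d] by simp
  also have "ip ?d f = ip f f + pairing ?b f"
    using ip_add[OF f comb_mem[OF b] f] ip_commute[OF comb_mem[OF b] f] ip_comb[OF b f] by simp
  finally show ?thesis
    by (simp add: comb_scale gain_def comb_form[OF a] flip: minus_mult_left)
qed

lemma gain_le_ip:
  assumes f: "f \<in> H" and a: "a \<in> lists (UNIV \<times> E)"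
  shows "gain M f a \<le> ip f f"
  using ip_diff_comb[OF f a] ip_nonneg[OF diff_mem[OF f comb_mem[OF a]]] by simp

text \<open>
  By \<open>ip_diff_comb\<close> the energy is at most the squared norm in any space with kernel \<open>M\<close>. The
  converse, together with the fact that all functions of finite energy belong to the space, is
  \<open>finite_energy_mem\<close>: combinations have the same norms on both sides, so a sequence of them that
  approximates \<open>f\<close> in energy is Cauchy in the space, and its limit there is \<open>f\<close>, as convergence in
  the space implies convergence in energy.
\<close>

lemma mem_finite_energy: "f \<in> H \<Longrightarrow> f \<in> finite_energy E M"
  using supported gain_le_ip by (auto intro!: finite_energyI)

lemma energy_le_ip: "f \<in> H \<Longrightarrow> energy E M f \<le> ip f f"
  using gain_le_ip by (intro energy_le)

lemma finite_energy_mem: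
  assumes f: "f \<in> finite_energy E M"
  shows "f \<in> H \<and> ip f f = energy E M f"
proof -
  obtain a where a: "\<And>n. a n \<in> lists (UNIV \<times> E)"
    and lim: "(\<lambda>n. energy E M (\<lambda>x. f x - comb E M (a n) x)) \<longlonglongrightarrow> 0"
    using energy_approx[OF f] by blast
  define G where "G n = comb E M (a n)" for n
  have G: "G n \<in> H" "G n \<in> finite_energy E M" for n
    using a by (auto simp: G_def comb_mem)
  have same: "ip (\<lambda>x. G m x - G n x) (\<lambda>x. G m x - G n x) = energy E M (\<lambda>x. G m x - G n x)" for m n
  proof -
    have ab: "a m @ scale_comb (-1) (a n) \<in> lists (UNIV \<times> E)"
      using a scale_comb_in_lists[OF a, of "-1"] by simp
    have "(\<lambda>x. G m x - G n x) = comb E M (a m @ scale_comb (-1) (a n))"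
      by (simp add: comb_append comb_scale G_def)
    then show ?thesis
      using ip_comb[OF ab comb_mem[OF ab]] energy_comb[OF ab] by simp
  qed
  have slim: "(\<lambda>n. sqrt (energy E M (\<lambda>x. f x - G n x))) \<longlonglongrightarrow> 0"
    using tendsto_real_sqrt[OF lim] by (simp add: G_def)
  have "\<exists>N. \<forall>m\<ge>N. \<forall>n\<ge>N. sqrt (ip (\<lambda>x. G m x - G n x) (\<lambda>x. G m x - G n x)) < e"
    if e: "e > 0" for e
  proof -
    obtain N where N: "\<And>n. n \<ge> N \<Longrightarrow> sqrt (energy E M (\<lambda>x. f x - G n x)) < e / 2"
      using order_tendstoD(2)[OF slim, of "e / 2"] e by (auto simp: eventually_sequentially)
    have "sqrt (energy E M (\<lambda>x. G m x - G n x)) < e" if "m \<ge> N" "n \<ge> N" for m n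
      using sqrt_energy_triangle[OF diff_finite_energy[OF G(2)[of m] f] diff_finite_energy[OF f G(2)[of n]]]
        N[OF that(1)] N[OF that(2)] energy_minus[OF G(2)[of m] f]
      by simp
    then show ?thesis unfolding same by blast
  qed
  from complete[OF G(1) this] obtain h where h: "h \<in> H"
    and hlim: "(\<lambda>n. sqrt (ip (\<lambda>x. G n x - h x) (\<lambda>x. G n x - h x))) \<longlonglongrightarrow> 0" by auto
  have h': "h \<in> finite_energy E M" using h by (rule mem_finite_energy)
  have "sqrt (energy E M (\<lambda>x. f x - h x)) \<le> 0"
  proof (rule LIMSEQ_le_const)
    show "(\<lambda>n. sqrt (energy E M (\<lambda>x. f x - G n x)) + sqrt (ip (\<lambda>x. G n x - h x) (\<lambda>x. G n x - h x)))
        \<longlonglongrightarrow> 0"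
      using tendsto_add[OF slim hlim] by simp
    have "sqrt (energy E M (\<lambda>x. f x - h x))
        \<le> sqrt (energy E M (\<lambda>x. f x - G n x)) + sqrt (ip (\<lambda>x. G n x - h x) (\<lambda>x. G n x - h x))" for n
    proof -
      have "sqrt (energy E M (\<lambda>x. f x - h x))
          \<le> sqrt (energy E M (\<lambda>x. f x - G n x)) + sqrt (energy E M (\<lambda>x. G n x - h x))"
        using sqrt_energy_triangle[OF diff_finite_energy[OF f G(2)] diff_finite_energy[OF G(2) h'], of n n]
        by simp
      with real_sqrt_le_mono[OF energy_le_ip[OF diff_mem[OF G(1) h]], of n] show ?thesis
        by linarith
    qed
    then show "\<exists>N. \<forall>n\<ge>N. sqrt (energy E M (\<lambda>x. f x - h x))
        \<le> sqrt (energy E M (\<lambda>x. f x - G n x)) + sqrt (ip (\<lambda>x. G n x - h x) (\<lambda>x. G n x - h x))"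
      by blast
  qed
  then have "(\<lambda>x. f x - h x) = (\<lambda>x. 0)"
    using energy_eq_0_iff[OF diff_finite_energy[OF f h']]
      energy_nonneg[OF diff_finite_energy[OF f h']] by simp
  then have fh: "f = h" by (simp add: fun_eq_iff)
  have "ip f f \<le> energy E M f + 0"
  proof (rule LIMSEQ_le_const)
    show "(\<lambda>n. energy E M f + (sqrt (ip (\<lambda>x. G n x - h x) (\<lambda>x. G n x - h x)))\<^sup>2) \<longlonglongrightarrow> energy E M f + 0"
      using tendsto_power[OF hlim, of 2] by (intro tendsto_intros) simp
    have "ip f f \<le> energy E M f + (sqrt (ip (\<lambda>x. G n x - h x) (\<lambda>x. G n x - h x)))\<^sup>2" for n
    proof -
      let ?d = "\<lambda>x. f x - G n x"
      have d: "?d \<in> H" using h G(1) fh by (simp add: diff_mem)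
      have "(\<lambda>x. G n x - h x) = (\<lambda>x. (-1) * ?d x)" by (simp add: fh)
      then have "ip (\<lambda>x. G n x - h x) (\<lambda>x. G n x - h x) = ip (\<lambda>x. (-1) * ?d x) (\<lambda>x. (-1) * ?d x)"
        by simp
      also have "\<dots> = ip ?d ?d"
        using ip_scale[OF d scale_mem[OF d], of "-1" "-1"] ip_scale[OF d d, of "-1"]
          ip_commute[OF d scale_mem[OF d], of "-1"] by simp
      also have "\<dots> = ip f f - gain M f (a n)"
        using ip_diff_comb[OF _ a] h fh by (simp add: G_def)
      finally show ?thesis
        using gain_le_energy[OF f a] ip_nonneg[OF diff_mem[OF G(1) h], of n]
        by (smt (verit) real_sqrt_pow2)
    qed
    then show "\<exists>N. \<forall>n\<ge>N. ip f f \<le> energy E M f + (sqrt (ip (\<lambda>x. G n x - h x) (\<lambda>x. G n x - h x)))\<^sup>2"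
      by blast
  qed
  with energy_le_ip[OF h] h fh show ?thesis by simp
qed

end

theorem (in psd_kernel)
  shows rkhs_eq_finite_energy: "rkhs E M = \<H>"
    and rkhs_norm_eq_energy: "f \<in> \<H> \<Longrightarrow> rkhs_norm E M f = sqrt (\<E> f)"
proof -
  have "\<exists>p. reproducing_kernel_hilbert_space E M (fst p) (snd p)"
    using rkhs_finite_energy by force
  then have "reproducing_kernel_hilbert_space E M (fst (rkhs_pair E M)) (snd (rkhs_pair E M))"
    unfolding rkhs_pair_def by (rule someI_ex)
  then interpret R: reproducing_kernel_hilbert_space E M "rkhs E M" "snd (rkhs_pair E M)"
    by (simp add: rkhs_def)
  show "rkhs E M = \<H>" "f \<in> \<H> \<Longrightarrow> rkhs_norm E M f = sqrt (\<E> f)"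
    using R.mem_finite_energy R.finite_energy_mem by (auto simp: rkhs_norm_def)
qed

text \<open>
  The action on functionals that is dual to the map \<open>f \<mapsto> w * (f \<circ> \<phi>)\<close> on functions.
\<close>

definition transport :: "('b \<Rightarrow> real) \<Rightarrow> ('b \<Rightarrow> 'a) \<Rightarrow> (real \<times> 'b) list \<Rightarrow> (real \<times> 'a) list" where
  "transport w \<phi> a = map (\<lambda>(c, x). (c * w x, \<phi> x)) a"

lemma pairing_transport [simp]: "pairing (transport w \<phi> a) f = pairing a (\<lambda>x. w x * f (\<phi> x))"
  by (induction a) (auto simp: transport_def)

lemma transport_image:
  assumes \<phi>: "bij_betw \<phi> E' E" and w: "\<And>x. x \<in> E' \<Longrightarrow> w x \<noteq> 0"
  shows "transport w \<phi> ` lists (UNIV \<times> E') = lists (UNIV \<times> E)"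
proof -
  have "(\<lambda>(c, x). (c * w x, \<phi> x)) ` (UNIV \<times> E') = UNIV \<times> E" (is "?L = ?R")
  proof (intro equalityI subsetI)
    fix p assume "p \<in> ?R"
    then obtain c x where p: "p = (c, \<phi> x)" and x: "x \<in> E'"
      using \<phi> by (auto simp: bij_betw_def)
    then show "p \<in> ?L"
      using w[OF x] by (intro image_eqI[of _ _ "(c / w x, x)"]) auto
  qed (use \<phi> in \<open>auto simp: bij_betw_def\<close>)
  then have "lists (UNIV \<times> E) = map (\<lambda>(c, x). (c * w x, \<phi> x)) ` lists (UNIV \<times> E')"
    using lists_image[of "\<lambda>(c, x). (c * w x, \<phi> x)" "UNIV \<times> E'"] by simp
  then show ?thesis
    by (simp add: transport_def)
qed

text \<open>
  Transporting the test combinations identifies the gains of \<open>T f\<close> with the gains of \<open>f\<close>, and since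
  every combination on \<open>E\<close> is transported from one on \<open>E'\<close>, the two suprema agree.
\<close>

lemma (in psd_kernel)
  fixes E' :: "'b set" and \<phi> :: "'b \<Rightarrow> 'a" and w :: "'b \<Rightarrow> real"
  assumes \<phi>: "bij_betw \<phi> E' E" and w: "\<And>x. x \<in> E' \<Longrightarrow> w x \<noteq> 0"
    and M': "\<And>x y. x \<in> E' \<Longrightarrow> y \<in> E' \<Longrightarrow> M' x y = w x * w y * M (\<phi> x) (\<phi> y)"
    and T: "\<And>f. T f = (\<lambda>x. if x \<in> E' then w x * f (\<phi> x) else 0)"
  shows psd_kernel_weighted_composition: "psd_kernel E' M'"
    and rkhs_weighted_composition: "rkhs_isometric_isomorphism E M E' M' T"
proof -
  let ?\<L>' = "lists (UNIV \<times> E') :: (real \<times> 'b) list set"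
  have \<phi>_mem: "x \<in> E' \<Longrightarrow> \<phi> x \<in> E" for x
    using \<phi> by (auto simp: bij_betw_def)
  have pair_T: "pairing a (T f) = pairing (transport w \<phi> a) f" if "a \<in> ?\<L>'" for a f
    using that by (simp, intro pairing_cong) (auto simp: T)
  have form: "pairing a (\<lambda>x. pairing a (M' x))
      = pairing (transport w \<phi> a) (\<lambda>x. pairing (transport w \<phi> a) (M x))"
    if a: "a \<in> ?\<L>'" for a
  proof -
    have "pairing a (M' x) = w x * pairing a (\<lambda>y. w y * M (\<phi> x) (\<phi> y))" if "x \<in> E'" for x
      unfolding pairing_mult[symmetric] using a that by (intro pairing_cong) (auto simp: M')
    then show ?thesis using a by (simp, intro pairing_cong) auto
  qed
  have gain: "gain M' (T f) a = gain M f (transport w \<phi> a)" if "a \<in> ?\<L>'" for a f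
    using that by (simp only: gain_def pair_T form)
  have surj: "transport w \<phi> ` ?\<L>' = \<L>"
    using \<phi> w by (rule transport_image)
  have image: "gain M' (T f) ` ?\<L>' = gain M f ` \<L>" for f
    using gain by (simp flip: surj add: image_image)
  interpret M': psd_kernel E' M'
  proof
    show "M' x y = M' y x" if "x \<in> E'" "y \<in> E'" for x y
      using that \<phi>_mem by (simp add: M' sym)
    show "0 \<le> pairing a (\<lambda>x. pairing a (M' x))" if "a \<in> ?\<L>'" for a
      unfolding form[OF that] using that surj by (intro psd) blast
  qed
  show "psd_kernel E' M'" by (rule M'.psd_kernel_axioms)
  have mem: "T f \<in> M'.\<H> \<longleftrightarrow> f \<in> \<H>" if "\<And>x. x \<notin> E \<Longrightarrow> f x = 0" for f
  proof -
    have "\<forall>x. x \<notin> E' \<longrightarrow> T f x = 0" by (simp add: T)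
    with that show ?thesis
      unfolding finite_energy_def mem_Collect_eq image by simp
  qed
  have en: "M'.\<E> (T f) = \<E> f" for f
    by (simp add: energy_def image)
  have "bij_betw T \<H> M'.\<H>"
  proof (intro bij_betw_imageI inj_onI equalityI subsetI)
    fix f g assume f: "f \<in> \<H>" and g: "g \<in> \<H>" and eq: "T f = T g"
    show "f = g"
    proof
      fix y show "f y = g y"
      proof (cases "y \<in> E")
        case True
        then obtain x where "x \<in> E'" "y = \<phi> x" using \<phi> by (auto simp: bij_betw_def)
        with fun_cong[OF eq, of x] w show ?thesis by (simp add: T)
      qed (use finite_energy_outside[OF f] finite_energy_outside[OF g] in simp)
    qed
  next
    fix g assume "g \<in> T ` \<H>"
    then show "g \<in> M'.\<H>" using mem by (auto dest: finite_energy_outside)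
  next
    fix g assume g: "g \<in> M'.\<H>"
    define \<psi> where "\<psi> = the_inv_into E' \<phi>"
    define f where "f y = (if y \<in> E then g (\<psi> y) / w (\<psi> y) else 0)" for y
    have \<psi>: "\<psi> (\<phi> x) = x" if "x \<in> E'" for x
      using that \<phi> by (simp add: \<psi>_def bij_betw_def the_inv_into_f_f)
    have "T f = g"
      using finite_energy_outside[OF g] w by (auto simp: T f_def \<psi> \<phi>_mem)
    then show "g \<in> T ` \<H>"
      using g mem[of f] by (auto simp: f_def)
  qed
  then show "rkhs_isometric_isomorphism E M E' M' T"
    unfolding rkhs_isometric_isomorphism_def rkhs_eq_finite_energy M'.rkhs_eq_finite_energy
    using mem en
    by (auto simp: rkhs_norm_eq_energy M'.rkhs_norm_eq_energy finite_energy_outside T algebra_simps fun_eq_iff)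
qed

lemma psd_kernel_rank_one_mult:
  assumes "psd_kernel E P"
  shows "psd_kernel E (\<lambda>x y. g x * g y * P x y)"
proof -
  interpret psd_kernel E P by fact
  show ?thesis
  proof
    show "g x * g y * P x y = g y * g x * P y x" if "x \<in> E" "y \<in> E" for x y
      using sym[OF that] by simp
    fix a :: "(real \<times> 'a) list" assume a: "a \<in> lists (UNIV \<times> E)"
    then have "transport g (\<lambda>x. x) a \<in> lists (UNIV \<times> E)" by (auto simp: transport_def)
    from psd[OF this] show "0 \<le> pairing a (\<lambda>x. pairing a (\<lambda>y. g x * g y * P x y))"
      by (simp add: mult.assoc)
  qed
qed

lemma psd_kernel_add:
  "psd_kernel E P \<Longrightarrow> psd_kernel E P' \<Longrightarrow> psd_kernel E (\<lambda>x y. P x y + P' x y)"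
  by (auto simp: psd_kernel_def)

lemma psd_kernel_zero: "psd_kernel E (\<lambda>x y. 0)"
  by (auto simp: psd_kernel_def)

lemma psd_kernel_const: "0 \<le> s \<Longrightarrow> psd_kernel E (\<lambda>x y. s)"
proof
  fix a :: "(real \<times> 'a) list" assume "0 \<le> s"
  moreover have "pairing a (\<lambda>x. t) = t * pairing a (\<lambda>x. 1)" for t
    using pairing_mult[of a t "\<lambda>_. 1"] by simp
  ultimately show "0 \<le> pairing a (\<lambda>x. pairing a (\<lambda>y. s))"
    by (metis mult.assoc mult_nonneg_nonneg zero_le_square)
qed auto

lemma psd_kernel_scale: "0 \<le> s \<Longrightarrow> psd_kernel E P \<Longrightarrow> psd_kernel E (\<lambda>x y. s * P x y)"
  by (auto simp: psd_kernel_def)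

lemma psd_kernel_limit:
  assumes P: "\<And>n. psd_kernel E (P n)"
    and lim: "\<And>x y. x \<in> E \<Longrightarrow> y \<in> E \<Longrightarrow> (\<lambda>n. P n x y) \<longlonglongrightarrow> M x y"
  shows "psd_kernel E M"
proof
  fix x y assume x: "x \<in> E" and y: "y \<in> E"
  have "(\<lambda>n. P n x y) = (\<lambda>n. P n y x)"
    using psd_kernel.sym[OF P x y] by simp
  with lim[OF x y] lim[OF y x] show "M x y = M y x"
    using LIMSEQ_unique by metis
next
  fix a :: "(real \<times> 'a) list" assume a: "a \<in> lists (UNIV \<times> E)"
  have "(\<lambda>n. pairing a (\<lambda>x. pairing a (P n x))) \<longlonglongrightarrow> pairing a (\<lambda>x. pairing a (M x))"
    using a lim by (intro tendsto_pairing[OF a]) auto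
  then show "0 \<le> pairing a (\<lambda>x. pairing a (M x))"
    using psd_kernel.psd[OF P a] by (intro LIMSEQ_le_const) auto
qed

text \<open>
  Multiplication by a kernel given as a nonnegative series of rank-one kernels preserves positive
  semidefiniteness. This replaces the Schur product theorem for the factors of the Hermite kernel.
\<close>

lemma psd_kernel_series_mult:
  assumes P: "psd_kernel E P" and w: "\<And>n. 0 \<le> w n"
    and sums: "\<And>x y. x \<in> E \<Longrightarrow> y \<in> E \<Longrightarrow> (\<lambda>n. w n * g n x * g n y) sums k x y"
  shows "psd_kernel E (\<lambda>x y. k x y * P x y)"
proof (rule psd_kernel_limit)
  show "psd_kernel E (\<lambda>x y. (\<Sum>n<N. w n * g n x * g n y) * P x y)" for N
  proof (induction N)
    case (Suc N)
    from psd_kernel_add[OF Suc psd_kernel_scale[OF w psd_kernel_rank_one_mult[OF P]], of N "g N"]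
    show ?case by (simp add: algebra_simps)
  qed (simp add: psd_kernel_zero)
  show "(\<lambda>N. (\<Sum>n<N. w n * g n x * g n y) * P x y) \<longlonglongrightarrow> k x y * P x y"
    if "x \<in> E" "y \<in> E" for x y
    using sums[OF that] by (intro tendsto_mult_right) (simp add: sums_def)
qed

section \<open>Mehler's formula\<close>

text \<open>
  The monic Hermite polynomials, whose three-term recurrence has polynomial coefficients.
\<close>

definition hermite_He :: "nat \<Rightarrow> real \<Rightarrow> real" where
  "hermite_He n x = sqrt (fact n) * hermite_h n x"

text \<open>
  The summands extended by \<open>0\<close> past \<open>n div 2\<close>, so that the sums for \<open>n\<close>, \<open>n + 1\<close> and \<open>n + 2\<close> can be
  taken over one common range.
\<close>

definition hermite_term :: "nat \<Rightarrow> real \<Rightarrow> nat \<Rightarrow> real" where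
  "hermite_term n x k =
    (if 2 * k \<le> n then fact n * (-1) ^ k * x ^ (n - 2 * k) / (2 ^ k * fact k * fact (n - 2 * k)) else 0)"

lemma hermite_He_eq_sum:
  assumes "n div 2 \<le> K"
  shows "hermite_He n x = (\<Sum>k\<le>K. hermite_term n x k)"
proof -
  have "hermite_He n x = (\<Sum>k\<in>{0..n div 2}. hermite_term n x k)"
    unfolding hermite_He_def hermite_h_def mult.assoc[symmetric] real_sqrt_mult_self abs_of_nonneg[OF fact_ge_zero] sum_distrib_left
    by (intro sum.cong) (auto simp: hermite_term_def)
  also have "\<dots> = (\<Sum>k\<le>K. hermite_term n x k)"
    using assms by (intro sum.mono_neutral_left) (auto simp: hermite_term_def)
  finally show ?thesis .
qed

lemma hermite_term_rec:
  "hermite_term (n + 2) x (Suc k) =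
    x * hermite_term (n + 1) x (Suc k) - (real n + 1) * hermite_term n x k"
proof (cases "2 * k \<le> n")
  case False
  then show ?thesis by (simp add: hermite_term_def)
next
  case True
  then obtain m where n: "n = m + 2 * k" using le_Suc_ex by (metis add.commute)
  show ?thesis
  proof (cases m)
    case 0
    then show ?thesis
      by (simp add: hermite_term_def n divide_simps)
  next
    case (Suc l)
    then show ?thesis
      by (simp add: hermite_term_def n divide_simps) (simp add: algebra_simps)
  qed
qed

lemma hermite_He_0 [simp]: "hermite_He 0 x = 1"
  and hermite_He_1 [simp]: "hermite_He (Suc 0) x = x"
  by (simp_all add: hermite_He_eq_sum[of _ 0] hermite_term_def)

lemma hermite_He_rec:
  "hermite_He (n + 2) x = x * hermite_He (n + 1) x - (real n + 1) * hermite_He n x"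
proof -
  define K where "K = n"
  have "hermite_He (n + 2) x = hermite_term (n + 2) x 0 + (\<Sum>k\<le>K. hermite_term (n + 2) x (Suc k))"
    by (subst hermite_He_eq_sum[of _ "Suc K"]) (simp_all add: K_def sum.atMost_Suc_shift del: sum.atMost_Suc)
  also have "hermite_term (n + 2) x 0 = x * hermite_term (n + 1) x 0"
    by (simp add: hermite_term_def)
  also have "x * hermite_term (n + 1) x 0 + (\<Sum>k\<le>K. hermite_term (n + 2) x (Suc k)) =
      x * (hermite_term (n + 1) x 0 + (\<Sum>k\<le>K. hermite_term (n + 1) x (Suc k)))
        - (real n + 1) * (\<Sum>k\<le>K. hermite_term n x k)"
    unfolding hermite_term_rec by (simp add: sum_subtractf sum_distrib_left algebra_simps)
  also have "(\<Sum>k\<le>K. hermite_term n x k) = hermite_He n x"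
    by (subst hermite_He_eq_sum[of _ K]) (simp_all add: K_def)
  also have "hermite_term (n + 1) x 0 + (\<Sum>k\<le>K. hermite_term (n + 1) x (Suc k)) = hermite_He (n + 1) x"
    by (subst hermite_He_eq_sum[of _ "Suc K"]) (simp_all add: K_def sum.atMost_Suc_shift del: sum.atMost_Suc)
  finally show ?thesis .
qed

lemma hermite_h_eq: "hermite_h n x = hermite_He n x / sqrt (fact n)"
  by (simp add: hermite_He_def)

lemma hermite_h_rec:
  "hermite_h (n + 2) x = (x * hermite_h (n + 1) x - sqrt (real n + 1) * hermite_h n x) / sqrt (real n + 2)"
proof -
  have "fact (n + 1) = (real n + 1) * fact n" "fact (n + 2) = (real n + 2) * ((real n + 1) * fact n)"
    by (simp_all add: algebra_simps)
  moreover have "(real n + 1) / sqrt (real n + 1) = sqrt (real n + 1)"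
    by (rule real_div_sqrt) simp
  ultimately show ?thesis
    unfolding hermite_h_eq hermite_He_rec
    by (simp only: real_sqrt_mult) (simp add: field_simps)
qed

text \<open>
  The recurrence gives \<open>\<bar>hermite_h (n + 2) x\<bar> \<le> (1 + \<bar>x\<bar> / sqrt (n + 2)) * B\<close> whenever \<open>B\<close> bounds the two
  preceding values, and the product of these factors grows like \<open>exp (2 * \<bar>x\<bar> * sqrt n)\<close>. Being
  subexponential, this makes Mehler's series converge for all \<open>\<bar>r\<bar> < 1\<close>.
\<close>

lemma hermite_h_bound_aux:
  "\<bar>hermite_h n x\<bar> \<le> exp (2 * \<bar>x\<bar> * sqrt (real n + 1)) \<and>
    \<bar>hermite_h (n + 1) x\<bar> \<le> exp (2 * \<bar>x\<bar> * sqrt (real n + 1))"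
proof (induction n)
  case 0
  have "\<bar>x\<bar> \<le> exp (2 * \<bar>x\<bar>)"
    using exp_ge_add_one_self[of "2 * \<bar>x\<bar>"] by linarith
  then show ?case by (simp add: hermite_h_eq)
next
  case (Suc n)
  let ?B = "exp (2 * \<bar>x\<bar> * sqrt (real n + 1))"
  have gap: "1 / sqrt (real n + 2) \<le> 2 * (sqrt (real n + 2) - sqrt (real n + 1))"
  proof -
    define s t where "s = sqrt (real n + 1)" and "t = sqrt (real n + 2)"
    have "s < t" "0 < s" "t * t = s * s + 1"
      by (simp_all add: s_def t_def)
    have "1 = (t - s) * (t + s)"
      using \<open>t * t = s * s + 1\<close> by (simp add: algebra_simps)
    also have "\<dots> \<le> (t - s) * (2 * t)"
      using \<open>s < t\<close> by (intro mult_left_mono) auto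
    finally have "1 \<le> 2 * (t - s) * t" by (simp add: mult_ac)
    with \<open>s < t\<close> \<open>0 < s\<close> show ?thesis
      unfolding s_def[symmetric] t_def[symmetric] by (simp add: field_simps)
  qed
  have "\<bar>hermite_h (n + 2) x\<bar>
      \<le> (\<bar>x\<bar> * \<bar>hermite_h (n + 1) x\<bar> + sqrt (real n + 1) * \<bar>hermite_h n x\<bar>) / sqrt (real n + 2)"
    unfolding hermite_h_rec abs_divide
    by (auto intro!: divide_right_mono order_trans[OF abs_triangle_ineq4] simp: abs_mult)
  also have "\<dots> \<le> (\<bar>x\<bar> * ?B + sqrt (real n + 2) * ?B) / sqrt (real n + 2)"
    using Suc by (intro divide_right_mono add_mono mult_mono) auto
  also have "\<dots> = ?B * (1 + \<bar>x\<bar> * (1 / sqrt (real n + 2)))"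
    by (simp add: field_simps)
  also have "\<dots> \<le> ?B * exp (\<bar>x\<bar> * (2 * (sqrt (real n + 2) - sqrt (real n + 1))))"
    using gap exp_ge_add_one_self
    by (intro mult_left_mono order_trans[OF exp_ge_add_one_self] iffD2[OF exp_le_cancel_iff]) auto
  also have "\<dots> = exp (2 * \<bar>x\<bar> * sqrt (real n + 2))"
    by (simp add: mult_exp_exp algebra_simps)
  finally have "\<bar>hermite_h (n + 2) x\<bar> \<le> exp (2 * \<bar>x\<bar> * sqrt (real n + 2))" .
  moreover have "?B \<le> exp (2 * \<bar>x\<bar> * sqrt (real n + 2))"
    by (intro iffD2[OF exp_le_cancel_iff] mult_left_mono) auto
  moreover have "\<bar>hermite_h (n + 1) x\<bar> \<le> exp (2 * \<bar>x\<bar> * sqrt (real n + 2))"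
    using Suc calculation(2) by linarith
  ultimately show ?case by (simp add: add.commute)
qed

lemma hermite_h_bound: "\<bar>hermite_h n x\<bar> \<le> exp (2 * \<bar>x\<bar> * sqrt (real n + 1))"
  using hermite_h_bound_aux by blast

lemma summable_power_exp_sqrt:
  fixes r C :: real
  assumes "0 \<le> r" "r < 1" and C: "0 < C"
  shows "summable (\<lambda>n. exp (C * sqrt (real n + 1)) * r ^ n)"
proof (cases "r = 0")
  case True
  then show ?thesis by (intro summable_finite[of "{0}"]) auto
next
  case False
  with assms have r: "0 < r" "r < 1" by auto
  define q where "q = - ln r"
  have q: "q > 0" and r_eq: "r ^ n = exp (- q * real n)" for n
    using r exp_of_nat_mult[of n "ln r"] by (auto simp: q_def mult.commute)
  have "(\<lambda>n. exp (C * sqrt (real n + 1)) * r ^ n) \<in> O(\<lambda>n. 1 / real n ^ 2)"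
    unfolding r_eq using q C by real_asymp
  moreover have "summable (\<lambda>n. norm (1 / real n ^ 2))"
    using inverse_power_summable[of 2, where 'a = real] by (simp add: inverse_eq_divide)
  ultimately show ?thesis
    by (rule summable_comparison_test_bigo[rotated])
qed

definition mehler_fps :: "real \<Rightarrow> real \<Rightarrow> real fps" where
  "mehler_fps x y = Abs_fps (\<lambda>n. hermite_h n x * hermite_h n y)"

lemma fps_conv_radius_mehler: "fps_conv_radius (mehler_fps x y) \<ge> 1"
  unfolding fps_conv_radius_def
proof (rule conv_radius_geI_ex)
  fix r :: real assume r: "0 < r" "ereal r < 1"
  have "summable (\<lambda>n. norm (fps_nth (mehler_fps x y) n * r ^ n))"
  proof (rule summable_comparison_test', rule summable_power_exp_sqrt)
    show "0 \<le> r" "r < 1" "0 < 2 * \<bar>x\<bar> + 2 * \<bar>y\<bar> + 1" using r by auto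
    show "norm (norm (fps_nth (mehler_fps x y) n * r ^ n)) \<le> exp ((2 * \<bar>x\<bar> + 2 * \<bar>y\<bar> + 1) * sqrt (real n + 1)) * r ^ n"
      if "n \<ge> 0" for n
    proof -
      have "\<bar>hermite_h n x\<bar> * \<bar>hermite_h n y\<bar>
          \<le> exp (2 * \<bar>x\<bar> * sqrt (real n + 1)) * exp (2 * \<bar>y\<bar> * sqrt (real n + 1))"
        by (intro mult_mono hermite_h_bound) auto
      also have "\<dots> \<le> exp ((2 * \<bar>x\<bar> + 2 * \<bar>y\<bar> + 1) * sqrt (real n + 1))"
        by (simp add: mult_exp_exp distrib_right)
      finally show ?thesis
        using r by (auto simp: mehler_fps_def abs_mult intro!: mult_right_mono)
    qed
  qed
  then have "summable (\<lambda>n. fps_nth (mehler_fps x y) n * r ^ n)" by (rule summable_norm_cancel)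
  with r show "\<exists>z. norm z = r \<and> summable (\<lambda>n. fps_nth (mehler_fps x y) n * z ^ n)"
    by (intro exI[of _ r]) auto
qed

lemma mehler_fps_nth: "fps_nth (mehler_fps x y) n = hermite_He n x * hermite_He n y / fact n"
  by (simp add: mehler_fps_def hermite_h_eq)

lemma fps_of_poly_pCons_mult_nth:
  fixes a :: "'a :: comm_ring_1"
  shows "fps_nth (fps_of_poly (pCons a p) * f) n =
    a * fps_nth f n + (if n = 0 then 0 else fps_nth (fps_of_poly p * f) (n - 1))"
proof -
  have "fps_of_poly (pCons a p) * f = fps_const a * f + fps_X * (fps_of_poly p * f)"
    by (simp add: fps_of_poly_pCons algebra_simps)
  then show ?thesis by simp
qed

text \<open>
  As a function of \<open>r\<close>, the right-hand side \<open>G\<close> of Mehler's formula satisfies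
  \<open>(1 - r^2)^2 * G' = (r * (1 - r^2) + x * y * (1 + r^2) - r * (x^2 + y^2)) * G\<close>. The series satisfies
  the same equation: comparing coefficients and eliminating by the three-term recurrences in \<open>x\<close> and
  in \<open>y\<close> leaves a polynomial identity in the values at \<open>m\<close> and \<open>m + 1\<close>.
\<close>

lemma mehler_fps_ode:
  "fps_of_poly [:1, 0, -2, 0, 1:] * fps_deriv (mehler_fps x y) =
    fps_of_poly [:x * y, 1 - x\<^sup>2 - y\<^sup>2, x * y, -1:] * mehler_fps x y" (is "?l = ?r")
proof (rule fps_ext)
  fix n :: nat
  let ?p = "\<lambda>n. hermite_He n x" and ?q = "\<lambda>n. hermite_He n y"
  have he2: "hermite_He (Suc (Suc 0)) u = u * u - 1" for u
    using hermite_He_rec[of 0 u] by simp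
  have he3: "hermite_He (Suc (Suc (Suc 0))) u = u * (u * u - 1) - 2 * u" for u
    using hermite_He_rec[of 1 u] by (simp add: he2)
  have "n = 0 \<or> n = 1 \<or> n = 2 \<or> (\<exists>m. n = m + 3)"
    by presburger
  then consider "n = 0" | "n = 1" | "n = 2" | m where "n = m + 3"
    by blast
  then show "fps_nth ?l n = fps_nth ?r n"
  proof cases
    case 1
    then show ?thesis by (simp add: fps_of_poly_pCons_mult_nth mehler_fps_nth)
  next
    case 2
    then show ?thesis
      by (simp add: fps_of_poly_pCons_mult_nth mehler_fps_nth eval_nat_numeral he2)
        (simp add: field_simps)
  next
    case 3
    then show ?thesis
      by (simp add: fps_of_poly_pCons_mult_nth mehler_fps_nth eval_nat_numeral he2 he3)
        (simp add: field_simps)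
  next
    case (4 m)
    have rec: "?p (m + 2) = x * ?p (m + 1) - (real m + 1) * ?p m"
      "?p (m + 3) = x * ?p (m + 2) - (real m + 2) * ?p (m + 1)"
      "?p (m + 4) = x * ?p (m + 3) - (real m + 3) * ?p (m + 2)"
      "?q (m + 2) = y * ?q (m + 1) - (real m + 1) * ?q m"
      "?q (m + 3) = y * ?q (m + 2) - (real m + 2) * ?q (m + 1)"
      "?q (m + 4) = y * ?q (m + 3) - (real m + 3) * ?q (m + 2)"
      using hermite_He_rec[of m x] hermite_He_rec[of "m + 1" x] hermite_He_rec[of "m + 2" x]
        hermite_He_rec[of m y] hermite_He_rec[of "m + 1" y] hermite_He_rec[of "m + 2" y]
      by (simp_all add: eval_nat_numeral)
    have fact: "fact (m + 1) = (real m + 1) * fact m" "fact (m + 2) = (real m + 2) * ((real m + 1) * fact m)"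
      "fact (m + 3) = (real m + 3) * ((real m + 2) * ((real m + 1) * fact m))"
      "fact (m + 4) = (real m + 4) * ((real m + 3) * ((real m + 2) * ((real m + 1) * fact m)))"
      by (simp_all add: eval_nat_numeral algebra_simps)
    let ?a = "fps_nth (mehler_fps x y)"
    have "fps_nth ?l n = (real m + 4) * ?a (m + 4) - 2 * ((real m + 2) * ?a (m + 2)) + real m * ?a m"
      unfolding 4
      by (cases m; simp add: fps_of_poly_pCons_mult_nth eval_nat_numeral; simp add: algebra_simps)
    also have "\<dots> = x * y * ?a (m + 3) + (1 - x\<^sup>2 - y\<^sup>2) * ?a (m + 2) + x * y * ?a (m + 1) - ?a m"
    proof -
      have key: "?p (m + 4) * ?q (m + 4) - 2 * (real m + 2) * (real m + 3) * (?p (m + 2) * ?q (m + 2))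
          + real m * (real m + 1) * (real m + 2) * (real m + 3) * (?p m * ?q m)
        = x * y * (?p (m + 3) * ?q (m + 3)) + (1 - x\<^sup>2 - y\<^sup>2) * (real m + 3) * (?p (m + 2) * ?q (m + 2))
          + x * y * (real m + 2) * (real m + 3) * (?p (m + 1) * ?q (m + 1))
          - (real m + 1) * (real m + 2) * (real m + 3) * (?p m * ?q m)"
        unfolding rec power2_eq_square by algebra
      define P where "P = (real m + 3) * ((real m + 2) * ((real m + 1) * fact m))"
      have P: "P > 0" by (simp add: P_def add_nonneg_pos)
      have a: "(real m + 4) * ?a (m + 4) = ?p (m + 4) * ?q (m + 4) / P"
        "?a (m + 3) = ?p (m + 3) * ?q (m + 3) / P"
        "?a (m + 2) = (real m + 3) * (?p (m + 2) * ?q (m + 2)) / P"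
        "?a (m + 1) = (real m + 2) * (real m + 3) * (?p (m + 1) * ?q (m + 1)) / P"
        "?a m = (real m + 1) * (real m + 2) * (real m + 3) * (?p m * ?q m) / P"
        unfolding mehler_fps_nth fact P_def by (simp_all add: divide_simps)
      show ?thesis
        unfolding a using key P
        by (simp only: times_divide_eq_right mult.assoc flip: add_divide_distrib diff_divide_distrib)
    qed
    also have "\<dots> = fps_nth ?r n"
      unfolding 4
      by (simp add: fps_of_poly_pCons_mult_nth eval_nat_numeral)
    finally show ?thesis .
  qed
qed

text \<open>
  The series and the closed form solve the same linear first-order equation on \<open>(-1, 1)\<close> and agree
  at \<open>0\<close>: the product of the series with the reciprocal \<open>g\<close> of the closed form has derivative \<open>0\<close>.
\<close>

theorem mehler_formula:
  assumes r: "\<bar>r\<bar> < 1"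
  shows "(\<lambda>n. r ^ n * hermite_h n x * hermite_h n y) sums
    (exp ((2 * r * x * y - r\<^sup>2 * (x\<^sup>2 + y\<^sup>2)) / (2 * (1 - r\<^sup>2))) / sqrt (1 - r\<^sup>2))"
proof -
  define f where "f = mehler_fps x y"
  define F where "F = eval_fps f"
  define F' where "F' = eval_fps (fps_deriv f)"
  define g where "g r = sqrt (1 - r\<^sup>2) *
    exp (- ((2 * r * x * y - r\<^sup>2 * (x\<^sup>2 + y\<^sup>2)) / (2 * (1 - r\<^sup>2))))" for r
  have rad: "ereal \<bar>t\<bar> < fps_conv_radius f" if "\<bar>t\<bar> < 1" for t
  proof -
    have "ereal \<bar>t\<bar> < 1" using that by simp
    also have "1 \<le> fps_conv_radius f" unfolding f_def by (rule fps_conv_radius_mehler)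
    finally show ?thesis .
  qed
  have rad': "ereal \<bar>t\<bar> < fps_conv_radius (fps_deriv f)" if "\<bar>t\<bar> < 1" for t
    using rad[OF that] fps_conv_radius_deriv[of f] by (rule less_le_trans)
  have ode: "(1 - t\<^sup>2)\<^sup>2 * F' t = (t * (1 - t\<^sup>2) + x * y * (1 + t\<^sup>2) - t * (x\<^sup>2 + y\<^sup>2)) * F t"
    if t: "\<bar>t\<bar> < 1" for t
  proof -
    have "eval_fps (fps_of_poly [:1, 0, -2, 0, 1:]) t * F' t =
        eval_fps (fps_of_poly [:x * y, 1 - x\<^sup>2 - y\<^sup>2, x * y, -1:]) t * F t"
      using arg_cong[OF mehler_fps_ode[of x y], of "\<lambda>f. eval_fps f t"] rad[OF t] rad'[OF t]
      by (simp add: eval_fps_mult F_def F'_def f_def)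
    then show ?thesis by (simp add: power2_eq_square algebra_simps)
  qed
  have "((\<lambda>t. F t * g t) has_real_derivative 0) (at t)" if "t \<in> {-1<..<1}" for t
  proof -
    from that have t: "\<bar>t\<bar> < 1" by auto
    then have pos: "1 - t\<^sup>2 > 0" by (simp add: abs_square_less_1)
    have F: "(F has_field_derivative F' t) (at t)"
      unfolding F_def F'_def using rad[OF t] by (intro has_field_derivative_eval_fps) auto
    have g: "(g has_field_derivative
        - ((t * (1 - t\<^sup>2) + x * y * (1 + t\<^sup>2) - t * (x\<^sup>2 + y\<^sup>2)) / (1 - t\<^sup>2)\<^sup>2) * g t) (at t)"
    proof -
      define N where "N r = (2 * r * x * y - r\<^sup>2 * (x\<^sup>2 + y\<^sup>2)) / (2 * (1 - r\<^sup>2))" for r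
      have N: "(N has_field_derivative
          (x * y * (1 + t\<^sup>2) - t * (x\<^sup>2 + y\<^sup>2)) / (1 - t\<^sup>2)\<^sup>2) (at t)"
        unfolding N_def using pos
        by (auto intro!: derivative_eq_intros)
          (simp add: divide_simps power2_eq_square, simp add: algebra_simps)
      have S: "((\<lambda>r. sqrt (1 - r\<^sup>2)) has_field_derivative - (t / (1 - t\<^sup>2)) * sqrt (1 - t\<^sup>2)) (at t)"
        using pos by (auto intro!: derivative_eq_intros simp: divide_simps)
      have "g = (\<lambda>r. sqrt (1 - r\<^sup>2) * exp (- N r))"
        by (simp add: g_def N_def fun_eq_iff)
      moreover have "((\<lambda>r. sqrt (1 - r\<^sup>2) * exp (- N r)) has_field_derivative
          - ((t * (1 - t\<^sup>2) + x * y * (1 + t\<^sup>2) - t * (x\<^sup>2 + y\<^sup>2)) / (1 - t\<^sup>2)\<^sup>2) *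
            (sqrt (1 - t\<^sup>2) * exp (- N t))) (at t)"
        by (rule DERIV_cong[OF DERIV_mult[OF S DERIV_fun_exp[OF DERIV_minus[OF N]]]])
          (use pos in \<open>simp add: divide_simps power2_eq_square, simp add: algebra_simps\<close>)
      ultimately show ?thesis by simp
    qed
    have "F' t = (t * (1 - t\<^sup>2) + x * y * (1 + t\<^sup>2) - t * (x\<^sup>2 + y\<^sup>2)) / (1 - t\<^sup>2)\<^sup>2 * F t"
      using ode[OF t] pos by (simp add: nonzero_eq_divide_eq mult.commute)
    then have "F t * (- ((t * (1 - t\<^sup>2) + x * y * (1 + t\<^sup>2) - t * (x\<^sup>2 + y\<^sup>2)) / (1 - t\<^sup>2)\<^sup>2) * g t) + F' t * g t = 0"
      by simp
    with DERIV_mult[OF F g] show ?thesis by (simp add: add.commute mult.commute)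
  qed
  then have "F r * g r = F 0 * g 0"
    using r by (intro DERIV_isconst3[of "-1" 1 r 0 "\<lambda>t. F t * g t"]) auto
  also have "\<dots> = 1"
    by (simp add: F_def g_def f_def eval_fps_at_0 mehler_fps_nth)
  finally have "F r = 1 / g r" by (metis eq_divide_eq mult_zero_right zero_neq_one)
  also have "\<dots> = exp ((2 * r * x * y - r\<^sup>2 * (x\<^sup>2 + y\<^sup>2)) / (2 * (1 - r\<^sup>2))) / sqrt (1 - r\<^sup>2)"
    by (simp add: g_def exp_minus field_simps)
  finally have F: "F r = \<dots>" .
  have "(\<lambda>n. fps_nth f n * r ^ n) sums F r"
    unfolding F_def using rad[OF r] by (intro sums_eval_fps) simp
  then show ?thesis
    by (simp add: F f_def mehler_fps_def mult_ac)
qed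

section \<open>The Hermite kernel and the Gaussian kernel\<close>

lemma c_coef_gt_1: "0 < \<sigma> j \<Longrightarrow> 1 < c_coef \<sigma> j"
  unfolding c_coef_def by (simp add: gr_one_powr)

lemma c_coef_ge_1: "1 \<le> c_coef \<sigma> j"
  unfolding c_coef_def by (intro ge_one_powr_ge_zero) auto

lemma c_coef_pos [simp]: "0 < c_coef \<sigma> j"
  using c_coef_ge_1[of \<sigma> j] by linarith

lemma c_coef_power4: "(c_coef \<sigma> j) ^ 4 = 1 + 8 * (\<sigma> j)\<^sup>2"
proof -
  have "0 < 1 + 8 * (\<sigma> j)\<^sup>2" by (simp add: add_pos_nonneg)
  then show ?thesis
    by (simp add: c_coef_def powr_powr flip: powr_realpow)
qed

lemma c_coef_square_sub_1: "((c_coef \<sigma> j)\<^sup>2 - 1) * ((c_coef \<sigma> j)\<^sup>2 + 1) = 8 * (\<sigma> j)\<^sup>2"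
  using c_coef_power4[of \<sigma> j] by (simp add: algebra_simps eval_nat_numeral)

lemma c_coef_square_le: "(c_coef \<sigma> j)\<^sup>2 - 1 \<le> 4 * (\<sigma> j)\<^sup>2"
proof -
  have "((c_coef \<sigma> j)\<^sup>2 - 1) * 2 \<le> ((c_coef \<sigma> j)\<^sup>2 - 1) * ((c_coef \<sigma> j)\<^sup>2 + 1)"
    using c_coef_ge_1[of \<sigma> j] by (intro mult_left_mono) (auto simp: one_le_power)
  then show ?thesis by (simp add: c_coef_square_sub_1)
qed

text \<open>
  Mehler's formula at \<open>r = \<beta> = (c^2 - 1) / (c^2 + 1)\<close>. Here \<open>1 - \<beta>^2 = (2 * c / (c^2 + 1))^2\<close> is a
  square, so the prefactor \<open>(1 - \<beta>) / sqrt (1 - \<beta>^2)\<close> is \<open>1 / c\<close>, and \<open>c^4 - 1 = 8 * \<sigma>^2\<close> turns the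
  coefficient of \<open>x * y\<close> into \<open>2 * \<sigma>^2 / c^2\<close>.
\<close>

lemma hermite_kernel_1_sums:
  assumes "0 < \<sigma> j"
  shows "(\<lambda>\<nu>. inverse (alpha_weight \<sigma> \<nu> j) * hermite_h \<nu> x * hermite_h \<nu> y) sums
    (exp (2 * (\<sigma> j)\<^sup>2 / (c_coef \<sigma> j)\<^sup>2 * x * y
      - ((c_coef \<sigma> j)\<^sup>2 - 1)\<^sup>2 / (8 * (c_coef \<sigma> j)\<^sup>2) * (x\<^sup>2 + y\<^sup>2)) / c_coef \<sigma> j)"
proof -
  define c b where "c = c_coef \<sigma> j" and "b = beta_coef \<sigma> j"
  have c: "1 < c" using c_coef_gt_1[of \<sigma> j, OF assms] by (simp add: c_def)
  have c2: "1 < c\<^sup>2" using c by (simp add: one_less_power)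
  have s: "2 * (\<sigma> j)\<^sup>2 = (c\<^sup>2 - 1) * (c\<^sup>2 + 1) / 4"
    using c_coef_square_sub_1[of \<sigma> j] by (simp add: c_def)
  have b: "b = (c\<^sup>2 - 1) / (c\<^sup>2 + 1)"
    using c2 by (simp add: b_def beta_coef_def c_def[symmetric] field_simps)
  have b01: "0 < b" "b < 1" using c2 by (simp_all add: b)
  have nz: "c\<^sup>2 + 1 \<noteq> 0" using c2 by linarith
  have "1 - b\<^sup>2 = ((c\<^sup>2 + 1)\<^sup>2 - (c\<^sup>2 - 1)\<^sup>2) / (c\<^sup>2 + 1)\<^sup>2"
    unfolding b power_divide using nz by (simp only: diff_divide_distrib) simp
  also have "(c\<^sup>2 + 1)\<^sup>2 - (c\<^sup>2 - 1)\<^sup>2 = (2 * c)\<^sup>2"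
    by (simp add: power2_eq_square algebra_simps)
  finally have one_minus_square: "1 - b\<^sup>2 = (2 * c / (c\<^sup>2 + 1))\<^sup>2"
    by (simp add: power_divide)
  have one_minus: "1 - b = 2 / (c\<^sup>2 + 1)"
    using nz by (simp add: b field_simps)
  have root: "sqrt (1 - b\<^sup>2) = 2 * c / (c\<^sup>2 + 1)"
    using c c2 unfolding one_minus_square by simp
  have "(\<lambda>\<nu>. (1 - b) * (b ^ \<nu> * hermite_h \<nu> x * hermite_h \<nu> y)) sums
      ((1 - b) * (exp ((2 * b * x * y - b\<^sup>2 * (x\<^sup>2 + y\<^sup>2)) / (2 * (1 - b\<^sup>2))) / sqrt (1 - b\<^sup>2)))"
    using b01 by (intro sums_mult mehler_formula) auto
  also have "(\<lambda>\<nu>. (1 - b) * (b ^ \<nu> * hermite_h \<nu> x * hermite_h \<nu> y)) =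
      (\<lambda>\<nu>. inverse (alpha_weight \<sigma> \<nu> j) * hermite_h \<nu> x * hermite_h \<nu> y)"
    using b01 by (simp add: alpha_weight_def b_def mult_ac)
  also have "(1 - b) * (exp ((2 * b * x * y - b\<^sup>2 * (x\<^sup>2 + y\<^sup>2)) / (2 * (1 - b\<^sup>2))) / sqrt (1 - b\<^sup>2)) =
      exp (2 * (\<sigma> j)\<^sup>2 / c\<^sup>2 * x * y - (c\<^sup>2 - 1)\<^sup>2 / (8 * c\<^sup>2) * (x\<^sup>2 + y\<^sup>2)) / c"
  proof -
    have quot: "p / w / (2 * c / w)\<^sup>2 = p * w / (4 * c\<^sup>2)" if "w \<noteq> 0" for p w
      using c that by (simp add: divide_simps power2_eq_square)
    have e1: "b / (1 - b\<^sup>2) = 2 * (\<sigma> j)\<^sup>2 / c\<^sup>2"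
      unfolding one_minus_square unfolding s b quot[OF nz] by simp
    have e2: "b\<^sup>2 / (2 * (1 - b\<^sup>2)) = (c\<^sup>2 - 1)\<^sup>2 / (8 * c\<^sup>2)"
      using nz unfolding one_minus_square unfolding b by (simp add: power_divide power_mult_distrib)
    have "(2 * b * x * y - b\<^sup>2 * (x\<^sup>2 + y\<^sup>2)) / (2 * (1 - b\<^sup>2)) =
        b / (1 - b\<^sup>2) * x * y - b\<^sup>2 / (2 * (1 - b\<^sup>2)) * (x\<^sup>2 + y\<^sup>2)"
    proof -
      have "(2 * b * x * y - b\<^sup>2 * s) / (2 * d) = b / d * x * y - b\<^sup>2 / (2 * d) * s" for d s
        by (simp add: diff_divide_distrib)
      then show ?thesis .
    qed
    also have "\<dots> = 2 * (\<sigma> j)\<^sup>2 / c\<^sup>2 * x * y - (c\<^sup>2 - 1)\<^sup>2 / (8 * c\<^sup>2) * (x\<^sup>2 + y\<^sup>2)"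
      unfolding e1 e2 ..
    finally have exponent: "(2 * b * x * y - b\<^sup>2 * (x\<^sup>2 + y\<^sup>2)) / (2 * (1 - b\<^sup>2)) = \<dots>" .
    have "2 / w * (e / (2 * c / w)) = e / c" if "w \<noteq> 0" for w e
      using c that by (simp add: divide_simps)
    from this[OF nz] show ?thesis
      unfolding exponent root one_minus .
  qed
  finally show ?thesis by (simp add: c_def)
qed

lemma hermite_kernel_1_eq:
  assumes "0 < \<sigma> j"
  shows "hermite_kernel_1 \<sigma> j x y =
    exp (2 * (\<sigma> j)\<^sup>2 / (c_coef \<sigma> j)\<^sup>2 * x * y
      - ((c_coef \<sigma> j)\<^sup>2 - 1)\<^sup>2 / (8 * (c_coef \<sigma> j)\<^sup>2) * (x\<^sup>2 + y\<^sup>2)) / c_coef \<sigma> j"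
  unfolding hermite_kernel_1_def using hermite_kernel_1_sums[of \<sigma> j, OF assms] by (rule sums_unique[symmetric])

text \<open>
  After rescaling by \<open>c\<close> the mixed terms of the two exponents agree, and the remaining multiples of
  \<open>x^2 + y^2\<close> differ by \<open>\<sigma>^2 - (c^2 - 1)^2 / 8 = (c^2 - 1) / 4\<close>, which is what the Gaussian weights
  compensate.
\<close>

lemma gauss_kernel_1_eq_hermite_kernel_1:
  assumes "0 < \<sigma> j"
  defines "c \<equiv> c_coef \<sigma> j"
  shows "gauss_kernel_1 \<sigma> j x y =
    c * exp (- ((c\<^sup>2 - 1) / 4 * x\<^sup>2)) * exp (- ((c\<^sup>2 - 1) / 4 * y\<^sup>2)) * hermite_kernel_1 \<sigma> j (c * x) (c * y)"
proof -
  have c: "0 < c" by (simp add: c_def)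
  have s: "(c\<^sup>2 - 1) * (c\<^sup>2 + 1) = 8 * (\<sigma> j)\<^sup>2"
    using c_coef_square_sub_1[of \<sigma> j] by (simp add: c_def)
  have e1: "2 * (\<sigma> j)\<^sup>2 / c\<^sup>2 * (c * x) * (c * y) = 2 * (\<sigma> j)\<^sup>2 * x * y"
    using c by (simp add: power2_eq_square)
  have e2: "(c\<^sup>2 - 1)\<^sup>2 / (8 * c\<^sup>2) * ((c * x)\<^sup>2 + (c * y)\<^sup>2) = (c\<^sup>2 - 1)\<^sup>2 / 8 * (x\<^sup>2 + y\<^sup>2)"
  proof -
    have "(c * x)\<^sup>2 + (c * y)\<^sup>2 = c\<^sup>2 * (x\<^sup>2 + y\<^sup>2)"
      by (simp add: power_mult_distrib algebra_simps)
    then show ?thesis using c by simp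
  qed
  have "(c\<^sup>2 - 1) / 4 + (c\<^sup>2 - 1)\<^sup>2 / 8 = (\<sigma> j)\<^sup>2"
    using s by (simp add: power2_eq_square field_simps)
  then have "- ((\<sigma> j)\<^sup>2 * (x - y)\<^sup>2) = - (((c\<^sup>2 - 1) / 4 + (c\<^sup>2 - 1)\<^sup>2 / 8) * (x\<^sup>2 + y\<^sup>2)) + 2 * (\<sigma> j)\<^sup>2 * x * y"
    by (simp add: power2_eq_square algebra_simps)
  also have "\<dots> = - ((c\<^sup>2 - 1) / 4 * x\<^sup>2) + - ((c\<^sup>2 - 1) / 4 * y\<^sup>2)
      + (2 * (\<sigma> j)\<^sup>2 * x * y - (c\<^sup>2 - 1)\<^sup>2 / 8 * (x\<^sup>2 + y\<^sup>2))"
  proof -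
    have "- ((p + q) * (u + v)) + r = - (p * u) + - (p * v) + (r - q * (u + v))" for p q u v r :: real
      by (simp add: algebra_simps)
    then show ?thesis .
  qed
  finally show ?thesis
    unfolding hermite_kernel_1_eq[of \<sigma> j, OF assms(1)] c_def[symmetric] e1 e2 gauss_kernel_1_def
    using c by (simp add: exp_add[symmetric])
qed

locale square_summable =
  fixes \<sigma> :: "nat \<Rightarrow> real"
  assumes pos: "\<And>j. 0 < \<sigma> j"
    and summable: "summable (\<lambda>j. (\<sigma> j)\<^sup>2)"
begin

abbreviation "c \<equiv> c_coef \<sigma>"
abbreviation "\<XX> \<equiv> seq_domain \<sigma>"

definition log_weight :: "(nat \<Rightarrow> real) \<Rightarrow> real" where
  "log_weight x = (\<Sum>j. ((c j)\<^sup>2 - 1) / 4 * (x j)\<^sup>2)"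

definition weight :: "(nat \<Rightarrow> real) \<Rightarrow> real" where
  "weight x = c_star \<sigma> powr (1 / 2) * exp (- log_weight x)"

lemma summable_ln_c: "summable (\<lambda>j. ln (c j))"
proof (rule summable_comparison_test')
  show "summable (\<lambda>j. 4 * (\<sigma> j)\<^sup>2)" using summable by (rule summable_mult)
  fix j
  have "ln (c j) \<le> c j - 1" by (intro ln_le_minus_one) simp
  also have "\<dots> \<le> (c j)\<^sup>2 - 1"
    using c_coef_ge_1[of \<sigma> j] by (simp add: power2_eq_square)
  also have "\<dots> \<le> 4 * (\<sigma> j)\<^sup>2" by (rule c_coef_square_le)
  finally show "norm (ln (c j)) \<le> 4 * (\<sigma> j)\<^sup>2"
    using c_coef_ge_1[of \<sigma> j] by simp
qed

lemma prod_c_eq: "(\<Prod>j<J. c j) = exp (\<Sum>j<J. ln (c j))"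
  by (simp add: exp_sum)

lemma prod_c_tendsto: "(\<lambda>J. \<Prod>j<J. c j) \<longlonglongrightarrow> c_star \<sigma>"
  and c_star_eq: "c_star \<sigma> = exp (\<Sum>j. ln (c j))"
proof -
  have *: "(\<lambda>J. \<Prod>j<J. c j) \<longlonglongrightarrow> exp (\<Sum>j. ln (c j))"
    unfolding prod_c_eq using summable_LIMSEQ[OF summable_ln_c] by (rule tendsto_exp)
  then show "c_star \<sigma> = exp (\<Sum>j. ln (c j))"
    unfolding c_star_def lim_prod_def by (rule limI)
  with * show "(\<lambda>J. \<Prod>j<J. c j) \<longlonglongrightarrow> c_star \<sigma>" by simp
qed

lemma c_star_pos [simp]: "0 < c_star \<sigma>"
  by (simp add: c_star_eq)

lemma c_star_nonzero [simp]: "c_star \<sigma> \<noteq> 0"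
  by (simp add: c_star_eq)

lemma prod_c_le: "(\<Prod>j<J. c j) \<le> c_star \<sigma>"
  unfolding prod_c_eq c_star_eq
  using c_coef_ge_1 by (auto intro!: sum_le_suminf summable_ln_c)

lemma mem_seq_domain: "x \<in> \<XX> \<longleftrightarrow> summable (\<lambda>j. (\<sigma> j)\<^sup>2 * (x j)\<^sup>2)"
  by (simp add: seq_domain_def)

lemma summable_log_weight:
  assumes "x \<in> \<XX>"
  shows "summable (\<lambda>j. ((c j)\<^sup>2 - 1) / 4 * (x j)\<^sup>2)"
proof (rule summable_comparison_test')
  show "summable (\<lambda>j. (\<sigma> j)\<^sup>2 * (x j)\<^sup>2)" using assms by (simp add: mem_seq_domain)
  fix j
  have "1 \<le> (c j)\<^sup>2" using c_coef_ge_1[of \<sigma> j] by (simp add: one_le_power)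
  then show "norm (((c j)\<^sup>2 - 1) / 4 * (x j)\<^sup>2) \<le> (\<sigma> j)\<^sup>2 * (x j)\<^sup>2"
    using mult_right_mono[OF c_coef_square_le[of \<sigma> j], of "(x j)\<^sup>2"]
    by (simp add: abs_mult)
qed

lemma c_square_le: "(c j)\<^sup>2 \<le> 1 + 4 * (\<Sum>j. (\<sigma> j)\<^sup>2)"
proof -
  have "(\<sigma> j)\<^sup>2 \<le> (\<Sum>j. (\<sigma> j)\<^sup>2)"
    using sum_le_suminf[OF summable, of "{j}"] by simp
  with c_coef_square_le[of \<sigma> j] show ?thesis by linarith
qed

lemma t_map_mem:
  assumes "x \<in> \<XX>"
  shows "t_map \<sigma> x \<in> \<XX>"
  unfolding mem_seq_domain
proof (rule summable_comparison_test')
  let ?C = "1 + 4 * (\<Sum>j. (\<sigma> j)\<^sup>2)"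
  show "summable (\<lambda>j. ?C * ((\<sigma> j)\<^sup>2 * (x j)\<^sup>2))"
    using assms by (intro summable_mult) (simp add: mem_seq_domain)
  show "norm ((\<sigma> j)\<^sup>2 * (t_map \<sigma> x j)\<^sup>2) \<le> ?C * ((\<sigma> j)\<^sup>2 * (x j)\<^sup>2)" for j
    using mult_right_mono[OF c_square_le[of j], of "(\<sigma> j)\<^sup>2 * (x j)\<^sup>2"]
    by (simp add: t_map_def power_mult_distrib mult_ac)
qed

lemma divide_c_mem:
  assumes "x \<in> \<XX>"
  shows "(\<lambda>j. x j / c j) \<in> \<XX>"
  unfolding mem_seq_domain
proof (rule summable_comparison_test')
  show "summable (\<lambda>j. (\<sigma> j)\<^sup>2 * (x j)\<^sup>2)" using assms by (simp add: mem_seq_domain)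
  fix j
  have "1 \<le> (c j)\<^sup>2" using c_coef_ge_1[of \<sigma> j] by (simp add: one_le_power)
  then have "(x j)\<^sup>2 / (c j)\<^sup>2 \<le> (x j)\<^sup>2"
    using divide_left_mono[of 1 "(c j)\<^sup>2" "(x j)\<^sup>2"] c_coef_pos[of \<sigma> j] by simp
  from mult_left_mono[OF this, of "(\<sigma> j)\<^sup>2"]
  show "norm ((\<sigma> j)\<^sup>2 * (x j / c j)\<^sup>2) \<le> (\<sigma> j)\<^sup>2 * (x j)\<^sup>2"
    by (simp add: power_divide)
qed

lemma t_map_divide_c [simp]: "t_map \<sigma> (\<lambda>j. x j / c j) = x"
  by (simp add: t_map_def less_imp_neq[OF c_coef_pos, symmetric])

lemma t_map_cancel [simp]: "(\<lambda>j. t_map \<sigma> x j / c j) = x"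
  by (simp add: t_map_def less_imp_neq[OF c_coef_pos, symmetric])

lemma bij_betw_t_map: "bij_betw (t_map \<sigma>) \<XX> \<XX>"
  by (rule bij_betw_byWitness[where f' = "\<lambda>x j. x j / c j"])
    (auto intro: t_map_mem divide_c_mem)

lemma gauss_prod_tendsto:
  assumes "x \<in> \<XX>" "y \<in> \<XX>"
  shows "(\<lambda>J. \<Prod>j<J. gauss_kernel_1 \<sigma> j (x j) (y j)) \<longlonglongrightarrow> gauss_kernel \<sigma> x y"
proof -
  have "summable (\<lambda>j. (\<sigma> j)\<^sup>2 * (x j - y j)\<^sup>2)"
  proof (rule summable_comparison_test')
    show "summable (\<lambda>j. 2 * ((\<sigma> j)\<^sup>2 * (x j)\<^sup>2 + (\<sigma> j)\<^sup>2 * (y j)\<^sup>2))"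
      using assms by (intro summable_mult summable_add) (simp_all add: mem_seq_domain)
    fix j
    have "(x j - y j)\<^sup>2 \<le> 2 * ((x j)\<^sup>2 + (y j)\<^sup>2)"
      using zero_le_power2[of "x j + y j"] by (simp add: power2_eq_square algebra_simps)
    from mult_left_mono[OF this, of "(\<sigma> j)\<^sup>2"]
    show "norm ((\<sigma> j)\<^sup>2 * (x j - y j)\<^sup>2) \<le> 2 * ((\<sigma> j)\<^sup>2 * (x j)\<^sup>2 + (\<sigma> j)\<^sup>2 * (y j)\<^sup>2)"
      by (simp add: algebra_simps)
  qed
  then have "(\<lambda>J. exp (\<Sum>j<J. - ((\<sigma> j)\<^sup>2 * (x j - y j)\<^sup>2))) \<longlonglongrightarrow> exp (\<Sum>j. - ((\<sigma> j)\<^sup>2 * (x j - y j)\<^sup>2))"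
    by (intro tendsto_exp summable_LIMSEQ summable_minus)
  then have "(\<lambda>J. \<Prod>j<J. gauss_kernel_1 \<sigma> j (x j) (y j)) \<longlonglongrightarrow> exp (\<Sum>j. - ((\<sigma> j)\<^sup>2 * (x j - y j)\<^sup>2))"
    by (simp add: exp_sum gauss_kernel_1_def)
  then show ?thesis
    unfolding gauss_kernel_def lim_prod_def by (simp add: limI)
qed

lemma gauss_kernel_diag [simp]: "gauss_kernel \<sigma> x x = 1"
  by (simp add: gauss_kernel_def gauss_kernel_1_def lim_prod_def)

lemma weight_prod_tendsto:
  assumes "x \<in> \<XX>"
  shows "(\<lambda>J. exp (- (\<Sum>j<J. ((c j)\<^sup>2 - 1) / 4 * (x j)\<^sup>2))) \<longlonglongrightarrow> exp (- log_weight x)"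
  unfolding log_weight_def
  by (intro tendsto_exp tendsto_minus summable_LIMSEQ summable_log_weight assms)

lemma weight_pos [simp]: "0 < weight x"
  by (simp add: weight_def)

lemma kernels_prod:
  "(\<Prod>j<J. gauss_kernel_1 \<sigma> j (x j) (y j)) =
    (\<Prod>j<J. c j) * exp (- (\<Sum>j<J. ((c j)\<^sup>2 - 1) / 4 * (x j)\<^sup>2))
      * exp (- (\<Sum>j<J. ((c j)\<^sup>2 - 1) / 4 * (y j)\<^sup>2))
      * (\<Prod>j<J. hermite_kernel_1 \<sigma> j (t_map \<sigma> x j) (t_map \<sigma> y j))"
  unfolding gauss_kernel_1_eq_hermite_kernel_1[OF pos] t_map_def
  by (simp add: prod.distrib exp_sum flip: sum_negf)

text \<open>
  Convergence of the product for the Hermite kernel is inherited from the Gaussian kernel, since the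
  partial products differ by convergent factors with nonzero limits.
\<close>

lemma hermite_prod_tendsto_t_map:
  assumes x: "x \<in> \<XX>" and y: "y \<in> \<XX>"
  shows "(\<lambda>J. \<Prod>j<J. hermite_kernel_1 \<sigma> j (t_map \<sigma> x j) (t_map \<sigma> y j))
    \<longlonglongrightarrow> gauss_kernel \<sigma> x y / (weight x * weight y)"
proof -
  let ?d = "\<lambda>J. (\<Prod>j<J. c j) * exp (- (\<Sum>j<J. ((c j)\<^sup>2 - 1) / 4 * (x j)\<^sup>2))
      * exp (- (\<Sum>j<J. ((c j)\<^sup>2 - 1) / 4 * (y j)\<^sup>2))"
  have root: "c_star \<sigma> = c_star \<sigma> powr (1 / 2) * c_star \<sigma> powr (1 / 2)"
    by (simp add: abs_of_pos flip: powr_add)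
  have "?d \<longlonglongrightarrow> c_star \<sigma> * exp (- log_weight x) * exp (- log_weight y)"
    using x y by (intro tendsto_mult prod_c_tendsto weight_prod_tendsto)
  also have "c_star \<sigma> * exp (- log_weight x) * exp (- log_weight y) = weight x * weight y"
    by (subst root) (simp add: weight_def)
  finally have d: "?d \<longlonglongrightarrow> weight x * weight y" .
  have "weight x * weight y \<noteq> 0" using weight_pos by (metis less_irrefl mult_pos_pos)
  with tendsto_divide[OF gauss_prod_tendsto[OF x y] d]
  have "(\<lambda>J. (\<Prod>j<J. gauss_kernel_1 \<sigma> j (x j) (y j)) / ?d J)
      \<longlonglongrightarrow> gauss_kernel \<sigma> x y / (weight x * weight y)" by blast
  moreover have "?d J \<noteq> 0" for J
    by (simp add: less_imp_neq[OF c_coef_pos, symmetric])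
  ultimately show ?thesis
    by (simp add: kernels_prod)
qed

lemma hermite_prod_tendsto:
  assumes x: "x \<in> \<XX>" and y: "y \<in> \<XX>"
  shows "(\<lambda>J. \<Prod>j<J. hermite_kernel_1 \<sigma> j (x j) (y j)) \<longlonglongrightarrow> hermite_kernel \<sigma> x y"
  using hermite_prod_tendsto_t_map[OF divide_c_mem[OF x] divide_c_mem[OF y]]
  unfolding t_map_divide_c hermite_kernel_def lim_prod_def by (simp add: limI)

lemma gauss_kernel_eq:
  assumes x: "x \<in> \<XX>" and y: "y \<in> \<XX>"
  shows "gauss_kernel \<sigma> x y = weight x * weight y * hermite_kernel \<sigma> (t_map \<sigma> x) (t_map \<sigma> y)"
  using LIMSEQ_unique[OF hermite_prod_tendsto_t_map[OF x y]
      hermite_prod_tendsto[OF t_map_mem[OF x] t_map_mem[OF y]]]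
    weight_pos[of x] weight_pos[of y]
  by (simp add: field_simps)

text \<open>
  Induction over the finite partial products, adding one factor at a time as a series of rank-one
  kernels in a single coordinate; the infinite product is their pointwise limit.
\<close>

lemma psd_hermite_kernel: "psd_kernel \<XX> (hermite_kernel \<sigma>)"
proof (rule psd_kernel_limit)
  show "psd_kernel \<XX> (\<lambda>x y. \<Prod>j<J. hermite_kernel_1 \<sigma> j (x j) (y j))" for J
  proof (induction J)
    case 0
    show ?case using psd_kernel_const[of 1] by simp
  next
    case (Suc J)
    have "psd_kernel \<XX> (\<lambda>x y. hermite_kernel_1 \<sigma> J (x J) (y J)
        * (\<Prod>j<J. hermite_kernel_1 \<sigma> j (x j) (y j)))"
    proof (rule psd_kernel_series_mult[OF Suc])
      have "0 \<le> beta_coef \<sigma> J" "beta_coef \<sigma> J \<le> 1"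
        using one_le_power[OF c_coef_ge_1[of \<sigma> J], of 2] by (simp_all add: beta_coef_def)
      then show "0 \<le> inverse (alpha_weight \<sigma> \<nu> J)" for \<nu>
        by (simp add: alpha_weight_def)
      show "(\<lambda>\<nu>. inverse (alpha_weight \<sigma> \<nu> J) * hermite_h \<nu> (x J) * hermite_h \<nu> (y J))
          sums hermite_kernel_1 \<sigma> J (x J) (y J)" for x y :: "nat \<Rightarrow> real"
        using hermite_kernel_1_sums[OF pos] unfolding hermite_kernel_1_eq[OF pos] .
    qed
    then show ?case by (simp add: mult.commute)
  qed
qed (rule hermite_prod_tendsto)

lemma Q_op_eq: "Q_op \<sigma> f = (\<lambda>x. if x \<in> \<XX> then weight x * f (t_map \<sigma> x) else 0)"
  by (simp add: Q_op_def weight_def log_weight_def cong: if_cong)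

lemma psd_gauss_kernel: "psd_kernel \<XX> (gauss_kernel \<sigma>)"
  by (rule psd_kernel.psd_kernel_weighted_composition
      [OF psd_hermite_kernel bij_betw_t_map, where w = weight and T = "Q_op \<sigma>"])
    (simp_all add: gauss_kernel_eq Q_op_eq less_imp_neq[OF weight_pos, symmetric])

theorem rkhs_Q_op:
  "rkhs_isometric_isomorphism \<XX> (hermite_kernel \<sigma>) \<XX> (gauss_kernel \<sigma>) (Q_op \<sigma>)"
  by (rule psd_kernel.rkhs_weighted_composition
      [OF psd_hermite_kernel bij_betw_t_map, where w = weight])
    (simp_all add: gauss_kernel_eq Q_op_eq less_imp_neq[OF weight_pos, symmetric])

end

section \<open>Change of variables in the Gaussian sequence measure\<close>

abbreviation "\<mu>0 \<equiv> density lborel (\<lambda>x. ennreal (std_normal_density x))"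
abbreviation "\<mu> \<equiv> gauss_seq_measure"

lemma prob_space_std_normal: "prob_space \<mu>0"
  by (rule prob_space_normal_density) simp

interpretation gauss: product_prob_space "\<lambda>_. \<mu>0" "UNIV :: nat set"
  by (intro product_prob_spaceI prob_space_std_normal)

lemma gauss_seq_measure_eq: "\<mu> = Pi\<^sub>M UNIV (\<lambda>_. \<mu>0)"
  by (simp add: gauss_seq_measure_def)

lemma sets_gauss_seq_measure [measurable_cong]: "sets \<mu> = sets (Pi\<^sub>M UNIV (\<lambda>_. borel))"
  unfolding gauss_seq_measure_eq by (intro sets_PiM_cong) auto

lemma space_gauss_seq_measure [simp]: "space \<mu> = UNIV"
  by (simp add: gauss_seq_measure_eq space_PiM)

interpretation mu: prob_space \<mu>
  unfolding gauss_seq_measure_eq by (rule gauss.P.prob_space_axioms)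

lemma nn_integral_gauss_component:
  assumes [measurable]: "f \<in> borel_measurable borel"
  shows "(\<integral>\<^sup>+x. f (x j) \<partial>\<mu>) = (\<integral>\<^sup>+u. f u \<partial>\<mu>0)"
proof -
  have "(\<integral>\<^sup>+u. f u \<partial>\<mu>0) = (\<integral>\<^sup>+u. f u \<partial>distr (Pi\<^sub>M UNIV (\<lambda>_. \<mu>0)) \<mu>0 (\<lambda>x. x j))"
    by (subst gauss.PiM_component[of j]) simp_all
  also have "\<dots> = (\<integral>\<^sup>+x. f (x j) \<partial>\<mu>)"
    unfolding gauss_seq_measure_eq by (intro nn_integral_distr) measurable
  finally show ?thesis ..
qed

lemma nn_integral_gauss_prod:
  assumes [measurable]: "\<And>j. f j \<in> borel_measurable borel"
  shows "(\<integral>\<^sup>+x. (\<Prod>j<N. f j (x j)) \<partial>\<mu>) = (\<Prod>j<N. \<integral>\<^sup>+u. f j u \<partial>\<mu>0)"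
proof -
  have "(\<Prod>j<N. \<integral>\<^sup>+u. f j u \<partial>\<mu>0) = (\<integral>\<^sup>+x. (\<Prod>j<N. f j (x j)) \<partial>Pi\<^sub>M {..<N} (\<lambda>_. \<mu>0))"
    by (rule gauss.product_nn_integral_prod[symmetric]) auto
  also have "\<dots> = (\<integral>\<^sup>+x. (\<Prod>j<N. f j (x j))
      \<partial>distr (Pi\<^sub>M UNIV (\<lambda>_. \<mu>0)) (Pi\<^sub>M {..<N} (\<lambda>_. \<mu>0)) (\<lambda>x. restrict x {..<N}))"
    by (subst gauss.distr_PiM_restrict_finite) auto
  also have "\<dots> = (\<integral>\<^sup>+x. (\<Prod>j<N. f j (restrict x {..<N} j)) \<partial>\<mu>)"
    unfolding gauss_seq_measure_eq
    by (intro nn_integral_distr measurable_restrict_subset borel_measurable_prod_ennreal) auto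
  finally show ?thesis by simp
qed

text \<open>
  Substitution \<open>v = c * u\<close>: the weight turns the standard normal density at \<open>u\<close> into \<open>c\<close> times that
  at \<open>c * u\<close>.
\<close>

lemma nn_integral_gauss_scale:
  assumes c: "0 < c" and [measurable]: "f \<in> borel_measurable borel"
  shows "(\<integral>\<^sup>+u. ennreal (c * exp (- ((c\<^sup>2 - 1) / 2 * u\<^sup>2))) * f (c * u) \<partial>\<mu>0) = (\<integral>\<^sup>+u. f u \<partial>\<mu>0)"
proof -
  have dens: "c * exp (- ((c\<^sup>2 - 1) / 2 * u\<^sup>2)) * std_normal_density u = c * std_normal_density (c * u)" for u
    by (simp add: std_normal_density_def mult_exp_exp power_mult_distrib field_simps)
  have "(\<integral>\<^sup>+u. ennreal (c * exp (- ((c\<^sup>2 - 1) / 2 * u\<^sup>2))) * f (c * u) \<partial>\<mu>0)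
      = (\<integral>\<^sup>+u. ennreal (c * exp (- ((c\<^sup>2 - 1) / 2 * u\<^sup>2)) * std_normal_density u) * f (c * u) \<partial>lborel)"
    using c by (subst nn_integral_density) (auto simp: ennreal_mult' mult_ac)
  also have "\<dots> = ennreal c * (\<integral>\<^sup>+u. ennreal (std_normal_density (0 + c * u)) * f (0 + c * u) \<partial>lborel)"
    unfolding dens using c by (subst nn_integral_cmult[symmetric]) (auto simp: ennreal_mult' mult_ac)
  also have "\<dots> = (\<integral>\<^sup>+u. ennreal (std_normal_density u) * f u \<partial>lborel)"
    using c nn_integral_real_affine[of "\<lambda>u. ennreal (std_normal_density u) * f u" c 0] by simp
  also have "\<dots> = (\<integral>\<^sup>+u. f u \<partial>\<mu>0)"
    by (subst nn_integral_density) auto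
  finally show ?thesis .
qed

lemma nn_integral_std_normal_square: "(\<integral>\<^sup>+u. ennreal (u\<^sup>2) \<partial>\<mu>0) = 1"
proof -
  have "(\<integral>\<^sup>+u. ennreal (u\<^sup>2) \<partial>\<mu>0) = ennreal (\<integral>u. u ^ (2 * 1) \<partial>\<mu>0)"
    using std_normal_distribution_even_moments(2)[of 1]
    by (subst nn_integral_eq_integral) auto
  also have "\<dots> = 1" by (subst std_normal_distribution_even_moments) simp
  finally show ?thesis .
qed

lemma L2_fun_iff:
  "f \<in> L2_fun M \<longleftrightarrow> f \<in> borel_measurable M \<and> (\<integral>\<^sup>+x. ennreal ((f x)\<^sup>2) \<partial>M) < \<infinity>"
proof -
  have "(\<lambda>x. (f x)\<^sup>2) \<in> borel_measurable M" if "f \<in> borel_measurable M"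
    using that by (rule borel_measurable_power)
  then show ?thesis
    unfolding L2_fun_def integrable_iff_bounded mem_Collect_eq real_norm_def power2_abs abs_power2 by blast
qed

lemma L2_norm_eq:
  assumes "f \<in> borel_measurable M"
  shows "L2_norm M f = sqrt (enn2real (\<integral>\<^sup>+x. ennreal ((f x)\<^sup>2) \<partial>M))"
  unfolding L2_norm_def
  by (subst integral_eq_nn_integral) (use assms in \<open>auto intro: borel_measurable_power\<close>)

lemma AE_eq_iff_nn_integral_diff_square:
  fixes f g :: "'a \<Rightarrow> real"
  assumes [measurable]: "f \<in> borel_measurable M" "g \<in> borel_measurable M"
  shows "(AE x in M. f x = g x) \<longleftrightarrow> (\<integral>\<^sup>+x. ennreal ((f x - g x)\<^sup>2) \<partial>M) = 0"
  by (subst nn_integral_0_iff_AE) simp_all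

context square_summable
begin

lemma mem_seq_domain_iff_suminf: "x \<in> \<XX> \<longleftrightarrow> (\<Sum>j. ennreal ((\<sigma> j)\<^sup>2 * (x j)\<^sup>2)) \<noteq> \<infinity>"
proof
  assume "x \<in> \<XX>"
  then have "(\<Sum>j. ennreal ((\<sigma> j)\<^sup>2 * (x j)\<^sup>2)) = ennreal (\<Sum>j. (\<sigma> j)\<^sup>2 * (x j)\<^sup>2)"
    unfolding mem_seq_domain by (intro suminf_ennreal2) auto
  then show "(\<Sum>j. ennreal ((\<sigma> j)\<^sup>2 * (x j)\<^sup>2)) \<noteq> \<infinity>" by simp
next
  assume "(\<Sum>j. ennreal ((\<sigma> j)\<^sup>2 * (x j)\<^sup>2)) \<noteq> \<infinity>"
  then show "x \<in> \<XX>"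
    unfolding mem_seq_domain by (intro summable_suminf_not_top) auto
qed

lemma seq_domain_measurable [measurable]: "\<XX> \<in> sets \<mu>"
proof -
  have "\<XX> = {x \<in> space \<mu>. (\<Sum>j. ennreal ((\<sigma> j)\<^sup>2 * (x j)\<^sup>2)) \<noteq> \<infinity>}"
    by (auto simp: mem_seq_domain_iff_suminf)
  also have "\<dots> \<in> sets \<mu>" by measurable
  finally show ?thesis .
qed

text \<open>
  The expectation of \<open>\<Sum>j. \<sigma> j ^ 2 * x j ^ 2\<close> is \<open>\<Sum>j. \<sigma> j ^ 2\<close>, hence finite.
\<close>

lemma AE_seq_domain: "AE x in \<mu>. x \<in> \<XX>"
proof -
  have "(\<integral>\<^sup>+x. (\<Sum>j. ennreal ((\<sigma> j)\<^sup>2 * (x j)\<^sup>2)) \<partial>\<mu>) = (\<Sum>j. \<integral>\<^sup>+x. ennreal ((\<sigma> j)\<^sup>2 * (x j)\<^sup>2) \<partial>\<mu>)"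
    by (rule nn_integral_suminf) measurable
  also have "\<dots> = (\<Sum>j. ennreal ((\<sigma> j)\<^sup>2))"
  proof (rule suminf_cong)
    fix j
    have "(\<integral>\<^sup>+x. ennreal ((\<sigma> j)\<^sup>2 * (x j)\<^sup>2) \<partial>\<mu>) = ennreal ((\<sigma> j)\<^sup>2) * (\<integral>\<^sup>+x. ennreal ((x j)\<^sup>2) \<partial>\<mu>)"
      by (subst nn_integral_cmult[symmetric]) (auto simp: ennreal_mult')
    also have "(\<integral>\<^sup>+x. ennreal ((x j)\<^sup>2) \<partial>\<mu>) = 1"
      by (subst nn_integral_gauss_component) (auto simp: nn_integral_std_normal_square)
    finally show "(\<integral>\<^sup>+x. ennreal ((\<sigma> j)\<^sup>2 * (x j)\<^sup>2) \<partial>\<mu>) = ennreal ((\<sigma> j)\<^sup>2)" by simp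
  qed
  also have "\<dots> = ennreal (\<Sum>j. (\<sigma> j)\<^sup>2)"
    using summable by (intro suminf_ennreal2) auto
  finally have "(\<integral>\<^sup>+x. (\<Sum>j. ennreal ((\<sigma> j)\<^sup>2 * (x j)\<^sup>2)) \<partial>\<mu>) \<noteq> \<infinity>" by simp
  then have "AE x in \<mu>. (\<Sum>j. ennreal ((\<sigma> j)\<^sup>2 * (x j)\<^sup>2)) \<noteq> \<infinity>"
    by (rule nn_integral_PInf_AE[rotated]) measurable
  then show ?thesis
    by (simp add: mem_seq_domain_iff_suminf)
qed

lemma t_map_measurable [measurable]: "t_map \<sigma> \<in> \<mu> \<rightarrow>\<^sub>M \<mu>"
proof -
  have "t_map \<sigma> \<in> \<mu> \<rightarrow>\<^sub>M Pi\<^sub>M UNIV (\<lambda>_. borel)"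
    unfolding t_map_def by (rule measurable_PiM_single') (auto simp: space_PiM)
  then show ?thesis
    by (simp cong: measurable_cong_sets add: sets_gauss_seq_measure)
qed

lemma divide_c_measurable [measurable]: "(\<lambda>x j. x j / c j) \<in> \<mu> \<rightarrow>\<^sub>M \<mu>"
proof -
  have "(\<lambda>x j. x j / c j) \<in> \<mu> \<rightarrow>\<^sub>M Pi\<^sub>M UNIV (\<lambda>_. borel)"
    by (rule measurable_PiM_single') (auto simp: space_PiM)
  then show ?thesis
    by (simp cong: measurable_cong_sets add: sets_gauss_seq_measure)
qed

lemma weight_measurable [measurable]: "weight \<in> borel_measurable \<mu>"
  unfolding weight_def log_weight_def by measurable

lemma weight_square_limit:
  assumes "x \<in> \<XX>"
  shows "(\<lambda>N. \<Prod>j<N. c j * exp (- (((c j)\<^sup>2 - 1) / 2 * (x j)\<^sup>2))) \<longlonglongrightarrow> (weight x)\<^sup>2"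
proof -
  have eq: "(\<Prod>j<N. c j * exp (- (((c j)\<^sup>2 - 1) / 2 * (x j)\<^sup>2))) =
      (\<Prod>j<N. c j) * (exp (- (\<Sum>j<N. ((c j)\<^sup>2 - 1) / 4 * (x j)\<^sup>2)))\<^sup>2" for N
  proof -
    have "(\<Sum>j<N. - (((c j)\<^sup>2 - 1) / 2 * (x j)\<^sup>2)) = 2 * - (\<Sum>j<N. ((c j)\<^sup>2 - 1) / 4 * (x j)\<^sup>2)"
      unfolding sum_negf[symmetric] sum_distrib_left by (intro sum.cong) auto
    then show ?thesis
      by (simp only: prod.distrib exp_sum[symmetric] exp_double finite_lessThan)
  qed
  have "(weight x)\<^sup>2 = c_star \<sigma> * (exp (- log_weight x))\<^sup>2"
    by (simp add: weight_def power_mult_distrib power2_eq_square abs_of_pos flip: powr_add)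
  then show ?thesis
    unfolding eq using assms by (simp only:) (intro tendsto_intros prod_c_tendsto weight_prod_tendsto)
qed

text \<open>
  A finite measure is determined by its values on cylinders. For a cylinder over \<open>J\<close>, the partial
  products of the density reaching beyond \<open>J\<close> split into one-dimensional integrals, each of which is
  the normal measure of the corresponding side (\<open>nn_integral_gauss_scale\<close>), so they all give the
  measure of the cylinder. They are bounded by \<open>c_star\<close> and converge almost everywhere, hence the
  limit density gives the same value.
\<close>

lemma distr_weight_t_map:
  "distr (density \<mu> (\<lambda>x. ennreal (if x \<in> \<XX> then (weight x)\<^sup>2 else 0))) \<mu> (t_map \<sigma>) = \<mu>"
  (is "?P = \<mu>")
proof -
  let ?W = "\<lambda>x. ennreal (if x \<in> \<XX> then (weight x)\<^sup>2 else 0)"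
  have eq: "\<mu> (prod_emb UNIV (\<lambda>_. \<mu>0) J (Pi\<^sub>E J A)) = ?P (prod_emb UNIV (\<lambda>_. \<mu>0) J (Pi\<^sub>E J A))"
    if J: "finite J" and A: "\<And>i. i \<in> J \<Longrightarrow> A i \<in> sets \<mu>0" for J A
  proof -
    \<comment> \<open>Sides of the cylinder in all coordinates, so that the integrand becomes a product over all \<open>j < N\<close>.\<close>
    define B where "B j = (if j \<in> J then A j else UNIV)" for j
    have B [measurable]: "B j \<in> sets borel" for j using A[of j] by (auto simp: B_def)
    let ?C = "prod_emb UNIV (\<lambda>_. \<mu>0) J (Pi\<^sub>E J A)"
    have C: "?C = {x. \<forall>j\<in>J. x j \<in> A j}"
      by (simp add: set_eq_iff prod_emb_iff restrict_PiE_iff Pi_iff)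
    have C_sets [measurable]: "?C \<in> sets \<mu>"
      unfolding gauss_seq_measure_eq using J A by (intro sets_PiM_I) auto
    define g where "g j u = ennreal (c j * exp (- (((c j)\<^sup>2 - 1) / 2 * u\<^sup>2))) * indicator (B j) (c j * u)" for j u
    have g [measurable]: "g j \<in> borel_measurable borel" for j
      unfolding g_def by measurable
    have int_g: "(\<integral>\<^sup>+u. g j u \<partial>\<mu>0) = emeasure \<mu>0 (B j)" for j
      unfolding g_def by (subst nn_integral_gauss_scale) auto
    have "\<exists>N0. \<forall>j\<in>J. j < N0"
      using J by (rule iffD1[OF finite_nat_set_iff_bounded])
    then obtain N0 where N0: "\<And>j. j \<in> J \<Longrightarrow> j < N0"
      by blast
    have prod_g: "(\<Prod>j<N. g j (x j)) =
        ennreal (\<Prod>j<N. c j * exp (- (((c j)\<^sup>2 - 1) / 2 * (x j)\<^sup>2))) * indicator ?C (t_map \<sigma> x)"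
      if N: "N0 \<le> N" for N x
    proof -
      have "(\<Prod>j<N. indicator (B j) (c j * x j) :: ennreal) = indicator ?C (t_map \<sigma> x)"
      proof (cases "t_map \<sigma> x \<in> ?C")
        case True
        then have "indicator (B j) (c j * x j) = (1 :: ennreal)" for j
          by (auto simp: C B_def t_map_def)
        with True show ?thesis by simp
      next
        case False
        then obtain j where "j \<in> J" "c j * x j \<notin> A j" by (auto simp: C t_map_def)
        then have "\<exists>j\<in>{..<N}. indicator (B j) (c j * x j) = (0 :: ennreal)"
          using N0[of j] N by (intro bexI[of _ j]) (auto simp: B_def)
        with False show ?thesis by (simp add: prod_zero_iff)
      qed
      moreover have "(\<Prod>j<N. ennreal (c j * exp (- (((c j)\<^sup>2 - 1) / 2 * (x j)\<^sup>2)))) =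
          ennreal (\<Prod>j<N. c j * exp (- (((c j)\<^sup>2 - 1) / 2 * (x j)\<^sup>2)))"
        by (rule prod_ennreal) (intro mult_nonneg_nonneg less_imp_le[OF c_coef_pos] exp_ge_zero)
      ultimately show ?thesis
        unfolding g_def prod.distrib by (simp only:)
    qed
    \<comment> \<open>The shift by \<open>N0\<close> makes every partial product contain all constrained coordinates.\<close>
    have "(\<lambda>N. \<integral>\<^sup>+x. (\<Prod>j<N + N0. g j (x j)) \<partial>\<mu>) \<longlonglongrightarrow> (\<integral>\<^sup>+x. ?W x * indicator ?C (t_map \<sigma> x) \<partial>\<mu>)"
    proof (rule nn_integral_dominated_convergence[where w = "\<lambda>_. ennreal (c_star \<sigma>)"])
      show "(\<integral>\<^sup>+x. ennreal (c_star \<sigma>) \<partial>\<mu>) < \<infinity>"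
        by (simp add: mu.emeasure_space_1[simplified])
      show "AE x in \<mu>. (\<Prod>j<N + N0. g j (x j)) \<le> ennreal (c_star \<sigma>)" for N
      proof (rule AE_I2)
        fix x :: "nat \<Rightarrow> real"
        have "(\<Prod>j<N + N0. c j * exp (- (((c j)\<^sup>2 - 1) / 2 * (x j)\<^sup>2))) \<le> (\<Prod>j<N + N0. c j * 1)"
          using one_le_power[OF c_coef_ge_1, of \<sigma> _ 2]
          by (intro prod_mono conjI mult_left_mono) (auto simp: less_imp_le)
        also have "\<dots> \<le> c_star \<sigma>" using prod_c_le by simp
        finally show "(\<Prod>j<N + N0. g j (x j)) \<le> ennreal (c_star \<sigma>)"
          by (subst prod_g) (auto simp: indicator_def intro!: ennreal_leI)
      qed
      show "AE x in \<mu>. (\<lambda>N. \<Prod>j<N + N0. g j (x j)) \<longlonglongrightarrow> ?W x * indicator ?C (t_map \<sigma> x)"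
        using AE_seq_domain
      proof eventually_elim
        case (elim x)
        have "(\<lambda>N. ennreal (\<Prod>j<N + N0. c j * exp (- (((c j)\<^sup>2 - 1) / 2 * (x j)\<^sup>2))))
            \<longlonglongrightarrow> ennreal ((weight x)\<^sup>2)"
          by (intro tendsto_ennrealI LIMSEQ_ignore_initial_segment weight_square_limit elim)
        then show ?case
          using elim by (simp add: prod_g) (auto simp: indicator_def)
      qed
    qed measurable
    moreover have "(\<integral>\<^sup>+x. (\<Prod>j<N + N0. g j (x j)) \<partial>\<mu>) = \<mu> ?C" for N
    proof -
      have "(\<integral>\<^sup>+x. (\<Prod>j<N + N0. g j (x j)) \<partial>\<mu>) = (\<Prod>j<N + N0. emeasure \<mu>0 (B j))"
        by (simp add: nn_integral_gauss_prod int_g)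
      also have "\<dots> = (\<Prod>j\<in>J. emeasure \<mu>0 (B j))"
        using N0 prob_space.emeasure_space_1[OF prob_space_std_normal]
        by (intro prod.mono_neutral_right) (force simp: B_def)+
      also have "\<dots> = (\<Prod>j\<in>J. emeasure \<mu>0 (A j))"
        by (simp add: B_def)
      also have "\<dots> = \<mu> ?C"
        unfolding gauss_seq_measure_eq using J A by (subst gauss.emeasure_PiM_emb) auto
      finally show ?thesis .
    qed
    ultimately have "\<mu> ?C = (\<integral>\<^sup>+x. ?W x * indicator ?C (t_map \<sigma> x) \<partial>\<mu>)"
      by (simp add: LIMSEQ_const_iff)
    also have "\<dots> = ?P ?C"
      by (subst emeasure_distr, measurable, subst emeasure_density, measurable)
        (auto intro!: nn_integral_cong simp: indicator_def)
    finally show ?thesis .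
  qed
  have "\<mu> = ?P"
    by (rule measure_eqI_PiM_infinite[of _ UNIV "\<lambda>_. \<mu>0"])
      (auto simp: gauss_seq_measure_eq[symmetric] intro!: eq mu.finite_measure_axioms)
  then show ?thesis ..
qed

lemma nn_integral_weight_t_map:
  assumes [measurable]: "F \<in> borel_measurable \<mu>"
  shows "(\<integral>\<^sup>+x. (if x \<in> \<XX> then ennreal ((weight x)\<^sup>2) * F (t_map \<sigma> x) else 0) \<partial>\<mu>) = (\<integral>\<^sup>+x. F x \<partial>\<mu>)"
proof -
  have "(\<integral>\<^sup>+x. F x \<partial>\<mu>) = (\<integral>\<^sup>+x. F x \<partial>distr (density \<mu> (\<lambda>x. ennreal (if x \<in> \<XX> then (weight x)\<^sup>2 else 0))) \<mu> (t_map \<sigma>))"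
    by (simp add: distr_weight_t_map)
  also have "\<dots> = (\<integral>\<^sup>+x. ennreal (if x \<in> \<XX> then (weight x)\<^sup>2 else 0) * F (t_map \<sigma> x) \<partial>\<mu>)"
    by (subst nn_integral_distr, measurable, subst nn_integral_density, measurable)
  also have "\<dots> = (\<integral>\<^sup>+x. (if x \<in> \<XX> then ennreal ((weight x)\<^sup>2) * F (t_map \<sigma> x) else 0) \<partial>\<mu>)"
    by (intro nn_integral_cong) auto
  finally show ?thesis ..
qed

lemma Q_op_measurable [measurable]:
  assumes [measurable]: "f \<in> borel_measurable \<mu>"
  shows "Q_op \<sigma> f \<in> borel_measurable \<mu>"
  unfolding Q_op_eq by measurable

lemma nn_integral_Q_op_square:
  assumes [measurable]: "f \<in> borel_measurable \<mu>"
  shows "(\<integral>\<^sup>+x. ennreal ((Q_op \<sigma> f x)\<^sup>2) \<partial>\<mu>) = (\<integral>\<^sup>+x. ennreal ((f x)\<^sup>2) \<partial>\<mu>)"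
proof -
  have "(\<integral>\<^sup>+x. ennreal ((Q_op \<sigma> f x)\<^sup>2) \<partial>\<mu>) =
      (\<integral>\<^sup>+x. (if x \<in> \<XX> then ennreal ((weight x)\<^sup>2) * ennreal ((f (t_map \<sigma> x))\<^sup>2) else 0) \<partial>\<mu>)"
    by (intro nn_integral_cong) (simp add: Q_op_eq power_mult_distrib ennreal_mult)
  also have "\<dots> = (\<integral>\<^sup>+x. ennreal ((f x)\<^sup>2) \<partial>\<mu>)"
    by (rule nn_integral_weight_t_map) measurable
  finally show ?thesis .
qed

lemma Q_op_L2_iff: "f \<in> borel_measurable \<mu> \<Longrightarrow> Q_op \<sigma> f \<in> L2_fun \<mu> \<longleftrightarrow> f \<in> L2_fun \<mu>"
  by (simp add: L2_fun_iff nn_integral_Q_op_square)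

text \<open>
  Dividing by the weight and composing with the inverse of the scaling inverts \<open>Q\<close> on the domain;
  off the domain, where \<open>Q\<close> gives \<open>0\<close>, nothing can be prescribed, but that is a null set.
\<close>

lemma Q_op_inverse:
  assumes h: "h \<in> borel_measurable \<mu>"
  obtains f where "f \<in> borel_measurable \<mu>" "\<And>x. x \<in> \<XX> \<Longrightarrow> Q_op \<sigma> f x = h x"
proof
  let ?f = "\<lambda>y. h (\<lambda>j. y j / c j) / weight (\<lambda>j. y j / c j)"
  have "(\<lambda>y. h (\<lambda>j. y j / c j)) \<in> borel_measurable \<mu>" "(\<lambda>y. weight (\<lambda>j. y j / c j)) \<in> borel_measurable \<mu>"
    by (rule measurable_compose[OF divide_c_measurable h], rule measurable_compose[OF divide_c_measurable weight_measurable])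
  then show "?f \<in> borel_measurable \<mu>" by (rule borel_measurable_divide)
  show "Q_op \<sigma> ?f x = h x" if "x \<in> \<XX>" for x
    using that by (simp add: Q_op_eq less_imp_neq[OF weight_pos, symmetric])
qed

theorem L2_Q_op: "L2_isometric_isomorphism \<mu> (Q_op \<sigma>)"
  unfolding L2_isometric_isomorphism_def
proof (intro conjI ballI allI)
  have meas: "f \<in> borel_measurable \<mu>" if "f \<in> L2_fun \<mu>" for f
    using that by (simp add: L2_fun_def)
  fix f assume f: "f \<in> L2_fun \<mu>"
  note [measurable] = meas[OF f]
  show "Q_op \<sigma> f \<in> L2_fun \<mu>"
    using f by (simp add: Q_op_L2_iff)
  show "L2_norm \<mu> (Q_op \<sigma> f) = L2_norm \<mu> f"
    by (simp add: L2_norm_eq nn_integral_Q_op_square)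
  show "AE x in \<mu>. Q_op \<sigma> (\<lambda>y. a * f y) x = a * Q_op \<sigma> f x" for a
    by (simp add: Q_op_eq)
  fix g assume g: "g \<in> L2_fun \<mu>"
  note [measurable] = meas[OF g]
  show "AE x in \<mu>. Q_op \<sigma> (\<lambda>y. f y + g y) x = Q_op \<sigma> f x + Q_op \<sigma> g x"
    by (simp add: Q_op_eq algebra_simps)
  have "Q_op \<sigma> f x - Q_op \<sigma> g x = Q_op \<sigma> (\<lambda>x. f x - g x) x" for x
    by (simp add: Q_op_eq algebra_simps)
  then show "(AE x in \<mu>. f x = g x) = (AE x in \<mu>. Q_op \<sigma> f x = Q_op \<sigma> g x)"
    by (simp add: AE_eq_iff_nn_integral_diff_square nn_integral_Q_op_square)
next
  fix h assume h: "h \<in> L2_fun \<mu>"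
  obtain f where f: "f \<in> borel_measurable \<mu>" "\<And>x. x \<in> \<XX> \<Longrightarrow> Q_op \<sigma> f x = h x"
    using Q_op_inverse[of h] h by (auto simp: L2_fun_def)
  have AE: "AE x in \<mu>. Q_op \<sigma> f x = h x"
    using AE_seq_domain by eventually_elim (rule f)
  have "(\<integral>\<^sup>+x. ennreal ((Q_op \<sigma> f x)\<^sup>2) \<partial>\<mu>) = (\<integral>\<^sup>+x. ennreal ((h x)\<^sup>2) \<partial>\<mu>)"
    using AE by (intro nn_integral_cong_AE) auto
  then have "f \<in> L2_fun \<mu>"
    using h f by (simp add: L2_fun_iff nn_integral_Q_op_square)
  with AE show "\<exists>f\<in>L2_fun \<mu>. AE x in \<mu>. Q_op \<sigma> f x = h x" by blast
qed

interpretation K: psd_kernel \<XX> "hermite_kernel \<sigma>" by (rule psd_hermite_kernel)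

lemma hermite_kernel_measurable: "(\<lambda>y. hermite_kernel \<sigma> y x) \<in> borel_measurable \<mu>"
  unfolding hermite_kernel_def lim_prod_def hermite_kernel_1_eq[OF pos] by measurable

lemma rkhs_hermite_measurable:
  assumes "f \<in> rkhs \<XX> (hermite_kernel \<sigma>)"
  shows "f \<in> borel_measurable \<mu>"
proof -
  have "f \<in> K.\<H>" using assms by (simp add: K.rkhs_eq_finite_energy)
  from K.finite_energy_pointwise_limit_of_combs[OF this]
  obtain a where a: "\<And>x. (\<lambda>n. comb \<XX> (hermite_kernel \<sigma>) (a n) x) \<longlonglongrightarrow> f x"
    by blast
  have "(\<lambda>y. pairing b (hermite_kernel \<sigma> y)) \<in> borel_measurable \<mu>" for b
    by (induction b) (auto intro!: borel_measurable_add borel_measurable_times hermite_kernel_measurable)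
  then have combs: "comb \<XX> (hermite_kernel \<sigma>) b \<in> borel_measurable \<mu>" for b
    unfolding comb_def by measurable
  show ?thesis
  proof (rule borel_measurable_LIMSEQ_real)
    show "(\<lambda>n. comb \<XX> (hermite_kernel \<sigma>) (a n) x) \<longlonglongrightarrow> f x" for x by (rule a)
    show "comb \<XX> (hermite_kernel \<sigma>) (a n) \<in> borel_measurable \<mu>" for n by (rule combs)
  qed
qed

lemma rkhs_Q_op_image: "Q_op \<sigma> ` rkhs \<XX> (hermite_kernel \<sigma>) = rkhs \<XX> (gauss_kernel \<sigma>)"
  using rkhs_Q_op by (simp add: rkhs_isometric_isomorphism_def bij_betw_def)

text \<open>
  Elements of \<open>H(L)\<close> are bounded because \<open>L x x = 1\<close>. Integrability of \<open>f\<close> in \<open>H(K)\<close>, which need not be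
  bounded, follows from that of \<open>Q f\<close>, as \<open>Q\<close> preserves integrals of squares.
\<close>

theorem rkhs_L2:
  "rkhs \<XX> (gauss_kernel \<sigma>) \<subseteq> L2_fun \<mu>"
  "rkhs \<XX> (hermite_kernel \<sigma>) \<subseteq> L2_fun \<mu>"
proof -
  interpret L: psd_kernel \<XX> "gauss_kernel \<sigma>" by (rule psd_gauss_kernel)
  have Q: "Q_op \<sigma> f \<in> L2_fun \<mu>" if f: "f \<in> rkhs \<XX> (hermite_kernel \<sigma>)" for f
  proof -
    have Qf: "Q_op \<sigma> f \<in> L.\<H>"
      using f rkhs_Q_op_image by (auto simp: L.rkhs_eq_finite_energy)
    have "(Q_op \<sigma> f x)\<^sup>2 \<le> L.\<E> (Q_op \<sigma> f)" for x
      using L.point_le_energy[OF Qf, of x] energy_nonneg[OF Qf] by (cases "x \<in> \<XX>") (auto simp: Q_op_eq)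
    then have "(\<integral>\<^sup>+x. ennreal ((Q_op \<sigma> f x)\<^sup>2) \<partial>\<mu>) \<le> (\<integral>\<^sup>+x. ennreal (L.\<E> (Q_op \<sigma> f)) \<partial>\<mu>)"
      by (intro nn_integral_mono ennreal_leI)
    also have "\<dots> < \<infinity>" by (simp add: mu.emeasure_space_1[simplified])
    finally show ?thesis
      using rkhs_hermite_measurable[OF f] by (simp add: L2_fun_iff)
  qed
  then show "rkhs \<XX> (gauss_kernel \<sigma>) \<subseteq> L2_fun \<mu>"
    unfolding rkhs_Q_op_image[symmetric] by blast
  show "rkhs \<XX> (hermite_kernel \<sigma>) \<subseteq> L2_fun \<mu>"
    using Q Q_op_L2_iff rkhs_hermite_measurable by blast
qed

end

section \<open>The isometric isomorphisms\<close>

theorem theorem5p8: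
  fixes \<sigma> :: "nat \<Rightarrow> real"
  assumes "\<And>j. \<sigma> j > 0"
    and "summable (\<lambda>j. (\<sigma> j)\<^sup>2)"
  shows "
    L2_isometric_isomorphism gauss_seq_measure (Q_op \<sigma>) \<and>
    rkhs (seq_domain \<sigma>) (hermite_kernel \<sigma>) \<subseteq> L2_fun gauss_seq_measure \<and>
    rkhs (seq_domain \<sigma>) (gauss_kernel \<sigma>) \<subseteq> L2_fun gauss_seq_measure \<and>
    rkhs_isometric_isomorphism
      (seq_domain \<sigma>) (hermite_kernel \<sigma>) (seq_domain \<sigma>) (gauss_kernel \<sigma>) (Q_op \<sigma>)"
proof -
  interpret square_summable \<sigma>
    using assms by unfold_locales
  show ?thesis
    by (intro conjI L2_Q_op rkhs_L2 rkhs_Q_op)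
qed

end
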